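(* Let $\mathcal X,\mathcal Y$ be separable real Hilbert spaces, let $C\in L(\mathcal X)$, and consider the operator $A_C\colon L(\mathcal X,\mathcal Y)\to L(\mathcal X,\mathcal Y)$, $A_C[\theta]:=\theta C$. (a) The point spectra of $A_C$ and $C^*$ coincide and $\operatorname{eig}_\lambda(A_C)=\mathcal Y\otimes\operatorname{eig}_\lambda(C^* )$. More precisely, for $\lambda\in\mathbb C$, $v\in\mathcal X$ and $y\in\mathcal Y$, $$\bigl(\lambda\in\sigma_{\rm p}(C^* ),\ v\in\operatorname{eig}_\lambda(C^* ),\ y\in\mathcal Y\bigr)\iff\bigl(\lambda\in\sigma_{\rm p}(A_C),\ y\otimes v\in\operatorname{eig}_\lambda(A_C)\bigr).$$ Moreover, the operator $A_C\colon S_2(\mathcal X,\mathcal Y)\to S_2(\mathcal X,\mathcal Y)$, $A_C[\theta]=\theta C$, admits the following properties. (b) The adjoint of $A_C$ with respect to $\langle\cdot,\cdot\rangle_{S_2(\mathcal X,\mathcal Y)}$ is given by $A_C^*=A_{C^*}$. In particular, if $C$ is self-adjoint with respect to $\langle\cdot,\cdot\rangle_{\mathcal X}$, then $A_C$ is self-adjoint with respect to $\langle\cdot,\cdot\rangle_{S_2(\mathcal X,\mathcal Y)}$. (c) The spectra of $A_C$ and $C^*$ coincide, i.e. $\sigma_{\rm p}(A_C)=\sigma_{\rm p}(C^* )$, $\sigma_{\rm c}(A_C)=\sigma_{\rm c}(C^* )$ and $\sigma_{\rm r}(A_C)=\sigma_{\rm r}(C^* )$. (d) Let $C$ be compact and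 self-adjoint with spectral decomposition $$C=\sum_{\lambda\in\sigma_{\rm p}(C)}\lambda P_{\operatorname{eig}_\lambda(C)},$$ where $P_{\operatorname{eig}_\lambda(C)}\colon\mathcal X\to\mathcal X$ denotes the orthogonal projection operator onto $\operatorname{eig}_\lambda(C)$ and the series converges in operator norm. Then $A_C$ has the spectral decomposition $$A_C=\sum_{\lambda\in\sigma_{\rm p}(C)}\lambda P_{\mathcal Y\otimes\operatorname{eig}_\lambda(C)},$$ where $P_{\mathcal Y\otimes\operatorname{eig}_\lambda(C)}\colon S_2(\mathcal X,\mathcal Y)\to S_2(\mathcal X,\mathcal Y)$ denotes the orthogonal projection operator onto $\mathcal Y\otimes\operatorname{eig}_\lambda(C)$ and the series converges in operator norm. (e) Let $C$ be compact and self-adjoint. Then $A_C$ is compact if and only if $\mathcal Y$ is finite-dimensional.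
   Context: $L(\mathcal X,\mathcal Y)$ is the Banach space of bounded linear operators $\mathcal X\to\mathcal Y$ with the operator norm, and $L(\mathcal X)=L(\mathcal X,\mathcal X)$. $S_2(\mathcal X,\mathcal Y)$ is the Hilbert space of Hilbert--Schmidt operators $\mathcal X\to\mathcal Y$ with inner product $\langle A,B\rangle_{S_2(\mathcal X,\mathcal Y)}=\operatorname{tr}(A^*B)$. $C^*$ is the adjoint of $C$. For $y\in\mathcal Y$ and $x\in\mathcal X$, $y\otimes x\in L(\mathcal X,\mathcal Y)$ is the rank-one operator $v\mapsto\langle x,v\rangle_{\mathcal X}\,y$. The Hilbert tensor product $\mathcal Y\otimes\mathcal X$ is the completion of the linear span of all such rank-one operators with respect to the inner product determined by $\langle y\otimes x,y'\otimes x'\rangle_{\mathcal Y\otimes\mathcal X}=\langle y,y'\rangle_{\mathcal Y}\langle x,x'\rangle_{\mathcal X}$; it is identified with $S_2(\mathcal X,\mathcal Y)$ through the isometric isomorphism $S_2(\mathcal X,\mathcal Y)\cong\mathcal Y\otimes\mathcal X$. For a closed subspace $E\subseteq\mathcal X$, $\mathcal Y\otimes E$ is the Hilbert tensor product of $\mathcal Y$ and $E$, defined in the same way. For a bounded linear operator $T$ on a space $E$ (here $E$ is $\mathcal X$, $L(\mathcal X,\mathcal Y)$ or $S_2(\mathcal X,\mathcal Y)$): $\sigma_{\rm p}(T)$ is the set of $\lambda\in\mathbb C$ such that $T-\lambda\operatorname{Id}_E$ is not injective; $\sigma_{\rm c}(T)$ is the set of $\lambda\in\mathbb C$ such that $T-\lambda\operatorname{Id}_E$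 is injective, not surjective, and has range dense in $E$; $\sigma_{\rm r}(T)$ is the set of $\lambda\in\mathbb C$ such that $T-\lambda\operatorname{Id}_E$ is injective, not surjective, and has range not dense in $E$. For $\lambda\in\mathbb C$, $\operatorname{eig}_\lambda(T)=\ker(T-\lambda\operatorname{Id}_E)$.
   Formalization: Y≠{0} assumed for the spectral identities in (a),(c) and the equivalence in (a), whose "⇐" also needs y≠0; on L(X,Y), eig_λ(A_C)=Y⊗eig_λ(C* ) is claimed only for the Hilbert–Schmidt part (in full on S_2); in (e), "compact ⇒ Y finite-dimensional" needs C≠0. *)

theory Defs
  imports "HOL-Analysis.Analysis"
begin

lemma orthogonal_projection_exists:
  fixes E :: "'a::{real_inner,banach} set"
  assumes E: "subspace E" "closed E"
  shows "\<exists>p\<in>E. \<forall>z\<in>E. (x - p) \<bullet> z = 0"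
proof -
  define \<delta> where "\<delta> = (INF z\<in>E. (norm (x - z))\<^sup>2)"
  have bdd: "bdd_below ((\<lambda>z. (norm (x - z))\<^sup>2) ` E)"
    by (rule bdd_belowI[of _ 0]) auto
  have ne: "E \<noteq> {}" using E(1) subspace_0 by auto
  have \<delta>_le: "\<delta> \<le> (norm (x - z))\<^sup>2" if "z \<in> E" for z
    unfolding \<delta>_def by (rule cINF_lower[OF bdd that])
  have "\<exists>z\<in>E. (norm (x - z))\<^sup>2 < \<delta> + 1 / real (Suc n)" for n
    using cInf_lessD[of "(\<lambda>z. (norm (x - z))\<^sup>2) ` E" "\<delta> + 1 / real (Suc n)"] ne
    by (auto simp: \<delta>_def)
  then obtain p where p: "\<And>n. p n \<in> E" "\<And>n. (norm (x - p n))\<^sup>2 < \<delta> + 1 / real (Suc n)"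
    by metis
  have key: "(norm (p m - p n))\<^sup>2 \<le> 2 / real (Suc m) + 2 / real (Suc n)" for m n
  proof -
    have "(norm (p m - p n))\<^sup>2 = 2 * (norm (x - p m))\<^sup>2 + 2 * (norm (x - p n))\<^sup>2
        - 4 * (norm (x - (1/2) *\<^sub>R (p m + p n)))\<^sup>2"
      by (simp add: power2_norm_eq_inner algebra_simps inner_commute)
    moreover have "\<delta> \<le> (norm (x - (1/2) *\<^sub>R (p m + p n)))\<^sup>2"
      using E(1) p(1) by (intro \<delta>_le subspace_scale subspace_add) auto
    ultimately show ?thesis using p(2)[of m] p(2)[of n] by auto
  qed
  have "Cauchy p"
  proof (rule CauchyI)
    fix e :: real assume e: "0 < e"
    then obtain N :: nat where N: "4 / e\<^sup>2 < real N"
      using reals_Archimedean2 by blast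
    hence "4 / e\<^sup>2 < real (Suc N)" by simp
    hence "4 < real (Suc N) * e\<^sup>2" using e by (simp only: pos_divide_less_eq zero_less_power)
    hence N': "4 / real (Suc N) < e\<^sup>2" by (simp only: pos_divide_less_eq of_nat_0_less_iff zero_less_Suc mult.commute)
    have "norm (p m - p n) < e" if "m \<ge> N" "n \<ge> N" for m n
    proof -
      have "2 / real (Suc m) \<le> 2 / real (Suc N)" "2 / real (Suc n) \<le> 2 / real (Suc N)"
        using that by (auto simp: frac_le)
      hence "(norm (p m - p n))\<^sup>2 < e\<^sup>2" using key[of m n] N' by linarith
      thus ?thesis using e power_less_imp_less_base by force
    qed
    thus "\<exists>M. \<forall>m\<ge>M. \<forall>n\<ge>M. norm (p m - p n) < e" by blast
  qed
  then obtain q where q: "p \<longlonglongrightarrow> q" using Cauchy_convergent_iff convergent_def by blast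
  have qE: "q \<in> E" using closed_sequentially[OF E(2)] p(1) q by blast
  have "(\<lambda>n. (norm (x - p n))\<^sup>2) \<longlonglongrightarrow> (norm (x - q))\<^sup>2"
    by (intro tendsto_intros q)
  moreover have "(\<lambda>n. \<delta> + 1 / real (Suc n)) \<longlonglongrightarrow> \<delta> + 0"
    by (intro tendsto_intros LIMSEQ_inverse_real_of_nat[unfolded inverse_eq_divide])
  ultimately have q\<delta>: "(norm (x - q))\<^sup>2 \<le> \<delta> + 0"
    by (rule LIMSEQ_le) (use p(2) less_imp_le in blast)
  have "(x - q) \<bullet> z = 0" if z: "z \<in> E" for z
  proof (cases "z = 0")
    case False
    define t where "t = ((x - q) \<bullet> z) / (z \<bullet> z)"
    have "(norm (x - q))\<^sup>2 \<le> (norm (x - (q + t *\<^sub>R z)))\<^sup>2"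
      using \<delta>_le[OF subspace_add[OF E(1) qE subspace_scale[OF E(1) z, of t]]] q\<delta> by linarith
    also have "\<dots> = (norm (x - q))\<^sup>2 - 2 * t * ((x - q) \<bullet> z) + t * t * (z \<bullet> z)"
      by (simp add: power2_norm_eq_inner algebra_simps inner_commute)
    finally have "2 * t * ((x - q) \<bullet> z) \<le> t * t * (z \<bullet> z)" by linarith
    hence "((x - q) \<bullet> z)\<^sup>2 \<le> 0" using False
      by (simp add: t_def field_simps power2_eq_square)
    thus ?thesis by simp
  qed auto
  thus ?thesis using qE by blast
qed

lemma subspace_closure:
  fixes E :: "'a::real_normed_vector set"
  assumes "subspace E"
  shows "subspace (closure E)"
proof (rule subspaceI)
  show "0 \<in> closure E" using subspace_0[OF assms] closure_subset by blast
next
  fix x y assume "x \<in> closure E" "y \<in> closure E"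
  then obtain f g where fg: "\<And>n. f n \<in> E" "f \<longlonglongrightarrow> x" "\<And>n. g n \<in> E" "g \<longlonglongrightarrow> y"
    unfolding closure_sequential by blast
  hence "(\<lambda>n. f n + g n) \<longlonglongrightarrow> x + y" "\<And>n. f n + g n \<in> E"
    using assms by (auto intro: tendsto_add subspace_add)
  thus "x + y \<in> closure E" unfolding closure_sequential by (intro exI[of _ "\<lambda>n. f n + g n"]) blast
next
  fix x and c :: real assume "x \<in> closure E"
  then obtain f where f: "\<And>n. f n \<in> E" "f \<longlonglongrightarrow> x"
    unfolding closure_sequential by blast
  hence "(\<lambda>n. c *\<^sub>R f n) \<longlonglongrightarrow> c *\<^sub>R x" "\<And>n. c *\<^sub>R f n \<in> E"
    using assms by (auto intro: tendsto_scaleR subspace_scale)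
  thus "c *\<^sub>R x \<in> closure E" unfolding closure_sequential by (intro exI[of _ "\<lambda>n. c *\<^sub>R f n"]) blast
qed

lemma riesz_representation:
  fixes f :: "'a::{real_inner,banach} \<Rightarrow> real"
  assumes "bounded_linear f"
  shows "\<exists>r. \<forall>v. f v = v \<bullet> r"
proof (cases "\<forall>x. f x = 0")
  case True
  thus ?thesis by (intro exI[of _ 0]) auto
next
  case False
  then obtain x where x: "f x \<noteq> 0" by blast
  interpret bounded_linear f by fact
  define E where "E = {v. f v = 0}"
  have sub: "subspace E" by (auto simp: E_def subspace_def zero add scaleR)
  have cl: "closed E" unfolding E_def
    by (intro closed_Collect_eq continuous_intros continuous_on)
  obtain p where p: "p \<in> E" "\<forall>z\<in>E. (x - p) \<bullet> z = 0"
    using orthogonal_projection_exists[OF sub cl] by blast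
  define w where "w = x - p"
  have fw: "f w \<noteq> 0" using x p(1) by (simp add: w_def diff E_def)
  hence w0: "w \<noteq> 0" using zero by auto
  have "f v = v \<bullet> ((f w / (w \<bullet> w)) *\<^sub>R w)" for v
  proof -
    have "v - (f v / f w) *\<^sub>R w \<in> E" using fw by (simp add: E_def diff scaleR)
    hence "w \<bullet> (v - (f v / f w) *\<^sub>R w) = 0" using p(2) w_def by blast
    thus ?thesis using fw w0 by (simp add: field_simps inner_diff_right inner_commute)
  qed
  thus ?thesis by blast
qed

definition adj :: "('a::real_inner \<Rightarrow>\<^sub>L 'b::real_inner) \<Rightarrow> ('b \<Rightarrow>\<^sub>L 'a)" where
  "adj A = Blinfun (adjoint (blinfun_apply A))"

lemma adj_inner:
  fixes A :: "'a::{real_inner,banach} \<Rightarrow>\<^sub>L 'b::real_inner"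
  shows "A x \<bullet> y = x \<bullet> adj A y"
proof -
  have "\<exists>r. \<forall>x. A x \<bullet> y = x \<bullet> r" for y
    by (rule riesz_representation)
       (intro bounded_linear_compose[OF bounded_linear_inner_left] blinfun.bounded_linear_right)
  hence "\<exists>f'. \<forall>x y. A x \<bullet> y = x \<bullet> f' y" by metis
  hence *: "A x \<bullet> y = x \<bullet> adjoint A y" for x y
    unfolding adjoint_def using someI_ex[of "\<lambda>f'. \<forall>x y. A x \<bullet> y = x \<bullet> f' y"] by blast
  have lin: "linear (adjoint A)"
  proof (rule linearI)
    fix b1 b2 show "adjoint A (b1 + b2) = adjoint A b1 + adjoint A b2"
      by (rule vector_eq_ldot[THEN iffD1]) (simp only: inner_add_right *[symmetric] simp_thms)
  next
    fix r b show "adjoint A (r *\<^sub>R b) = r *\<^sub>R adjoint A b"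
      by (rule vector_eq_ldot[THEN iffD1]) (simp only: inner_scaleR_right *[symmetric] simp_thms)
  qed
  have "bounded_linear (adjoint A)"
  proof (rule bounded_linear_intro[of _ "norm A"])
    fix y
    have "(norm (adjoint A y))\<^sup>2 = A (adjoint A y) \<bullet> y" by (simp add: power2_norm_eq_inner *)
    also have "\<dots> \<le> norm (A (adjoint A y)) * norm y" by (rule norm_cauchy_schwarz)
    also have "\<dots> \<le> norm A * norm (adjoint A y) * norm y"
      by (intro mult_right_mono norm_blinfun) auto
    finally have "norm (adjoint A y) * norm (adjoint A y) \<le> norm (adjoint A y) * (norm y * norm A)"
      by (simp add: power2_eq_square mult_ac)
    thus "norm (adjoint A y) \<le> norm y * norm A"
      by (cases "norm (adjoint A y) = 0") (auto simp: mult_le_cancel_left)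
  qed (use lin in \<open>auto simp: linear_add linear_scale\<close>)
  thus ?thesis by (simp add: adj_def bounded_linear_Blinfun_apply *)
qed

lemma adj_inner': "adj A y \<bullet> x = y \<bullet> A x" for A :: "'a::{real_inner,banach} \<Rightarrow>\<^sub>L 'b::real_inner"
  using adj_inner[of A x y] by (simp only: inner_commute)

lemma adj_unique:
  fixes A :: "'a::{real_inner,banach} \<Rightarrow>\<^sub>L 'b::real_inner"
  assumes "\<And>x y. A x \<bullet> y = x \<bullet> blinfun_apply B y"
  shows "adj A = B"
  by (rule blinfun_eqI, rule vector_eq_ldot[THEN iffD1], rule allI) (simp only: assms flip: adj_inner)

lemma adj_adj [simp]: "adj (adj A) = A"
  for A :: "'a::{real_inner,banach} \<Rightarrow>\<^sub>L 'b::{real_inner,banach}"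
  by (rule adj_unique) (rule adj_inner')

lemma adj_compose: "adj (A o\<^sub>L B) = adj B o\<^sub>L adj A"
  for A :: "'b::{real_inner,banach} \<Rightarrow>\<^sub>L 'c::real_inner" and B :: "'a::{real_inner,banach} \<Rightarrow>\<^sub>L 'b"
  by (rule adj_unique) (simp add: adj_inner)

lemma norm_adj_le: "norm (adj A) \<le> norm A"
  for A :: "'a::{real_inner,banach} \<Rightarrow>\<^sub>L 'b::real_inner"
proof (rule norm_blinfun_bound)
  fix y
  have "(norm (adj A y))\<^sup>2 = A (adj A y) \<bullet> y" by (simp add: power2_norm_eq_inner adj_inner)
  also have "\<dots> \<le> norm (A (adj A y)) * norm y" by (rule norm_cauchy_schwarz)
  also have "\<dots> \<le> norm A * norm (adj A y) * norm y"
    by (intro mult_right_mono norm_blinfun) auto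
  finally have "norm (adj A y) * norm (adj A y) \<le> norm (adj A y) * (norm A * norm y)"
    by (simp add: power2_eq_square mult_ac)
  thus "norm (adj A y) \<le> norm A * norm y"
    by (cases "norm (adj A y) = 0") (auto simp: mult_le_cancel_left)
qed auto

definition orthonormal_set :: "'a::real_inner set \<Rightarrow> bool" where
  "orthonormal_set B \<longleftrightarrow> pairwise orthogonal B \<and> (\<forall>e\<in>B. norm e = 1)"

definition orthonormal_basis :: "'a::real_inner set \<Rightarrow> bool" where
  "orthonormal_basis B \<longleftrightarrow> orthonormal_set B \<and> closure (span B) = UNIV"

lemma orthonormal_basis_exists: "\<exists>B::'a::{real_inner,banach} set. orthonormal_basis B"
proof -
  have "\<exists>M\<in>{B::'a set. orthonormal_set B}. \<forall>X\<in>{B. orthonormal_set B}. M \<subseteq> X \<longrightarrow> X = M"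
  proof (rule subset_Zorn')
    fix \<C> :: "'a set set" assume C: "subset.chain {B. orthonormal_set B} \<C>"
    have "orthogonal x y" if xy: "x \<in> X" "X \<in> \<C>" "y \<in> Y" "Y \<in> \<C>" "x \<noteq> y" for x y X Y
    proof -
      have "X \<subseteq> Y \<or> Y \<subseteq> X" using C that by (auto simp: subset_chain_def)
      then obtain Z where Z: "Z \<in> \<C>" "x \<in> Z" "y \<in> Z" using xy by blast
      hence "orthonormal_set Z" using C unfolding subset_chain_def by blast
      thus ?thesis using Z xy(5) by (simp add: orthonormal_set_def pairwise_def)
    qed
    moreover have "norm x = 1" if "x \<in> X" "X \<in> \<C>" for x X
      using C that unfolding subset_chain_def orthonormal_set_def by blast
    ultimately show "\<Union>\<C> \<in> {B. orthonormal_set B}"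
      unfolding mem_Collect_eq orthonormal_set_def pairwise_def by blast
  qed
  then obtain B :: "'a set" where B: "orthonormal_set B"
    "\<And>X. orthonormal_set X \<Longrightarrow> B \<subseteq> X \<Longrightarrow> X = B" by blast
  have "closure (span B) = UNIV"
  proof (rule ccontr)
    assume "closure (span B) \<noteq> UNIV"
    then obtain x where x: "x \<notin> closure (span B)" by blast
    obtain p where p: "p \<in> closure (span B)" "\<forall>z\<in>closure (span B). (x - p) \<bullet> z = 0"
      using orthogonal_projection_exists[of "closure (span B)" x] by (auto simp: subspace_closure)
    define u where "u = (x - p) /\<^sub>R norm (x - p)"
    have "x \<noteq> p" using x p(1) by blast
    hence u: "norm u = 1" by (simp add: u_def)
    have "u \<bullet> e = 0" if "e \<in> B" for e
      using p(2) that closure_subset[of "span B"] span_base[of e B] by (auto simp: u_def)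
    hence "orthonormal_set (insert u B)" using B(1) u
      by (auto simp: orthonormal_set_def pairwise_insert orthogonal_def inner_commute)
    hence "insert u B = B" using B(2) by blast
    hence "u \<in> B" by blast
    hence "u \<bullet> u = 0" using \<open>\<And>e. e \<in> B \<Longrightarrow> u \<bullet> e = 0\<close> by blast
    thus False using u by auto
  qed
  thus ?thesis using B(1) orthonormal_basis_def by blast
qed

lemma orthonormal_inner:
  "orthonormal_set B \<Longrightarrow> a \<in> B \<Longrightarrow> b \<in> B \<Longrightarrow> a \<bullet> b = (if a = b then 1 else 0)"
  by (auto simp: orthonormal_set_def pairwise_def orthogonal_def norm_eq_1)

lemma orthonormal_residual:
  fixes x :: "'a::real_inner"
  assumes B: "orthonormal_set B" and F: "finite F" "F \<subseteq> B"
  shows "(norm (x - (\<Sum>e\<in>F. c e *\<^sub>R e)))\<^sup>2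
    = (norm x)\<^sup>2 - (\<Sum>e\<in>F. (x \<bullet> e)\<^sup>2) + (\<Sum>e\<in>F. (x \<bullet> e - c e)\<^sup>2)"
proof -
  have "(\<Sum>e\<in>F. c e *\<^sub>R e) \<bullet> (\<Sum>e\<in>F. c e *\<^sub>R e) = (\<Sum>a\<in>F. \<Sum>b\<in>F. if a = b then c a * c b else 0)"
    unfolding inner_sum_left inner_sum_right using orthonormal_inner[OF B] F(2)
    by (intro sum.cong refl) (auto simp: subset_iff)
  also have "\<dots> = (\<Sum>a\<in>F. (c a)\<^sup>2)" using F(1) by (simp add: power2_eq_square)
  finally have 1: "(\<Sum>e\<in>F. c e *\<^sub>R e) \<bullet> (\<Sum>e\<in>F. c e *\<^sub>R e) = (\<Sum>a\<in>F. (c a)\<^sup>2)" .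
  have "(norm (x - (\<Sum>e\<in>F. c e *\<^sub>R e)))\<^sup>2
     = (norm x)\<^sup>2 - 2 * (x \<bullet> (\<Sum>e\<in>F. c e *\<^sub>R e)) + (\<Sum>a\<in>F. (c a)\<^sup>2)"
    unfolding power2_norm_eq_inner 1[symmetric] by (simp add: algebra_simps inner_commute)
  also have "\<dots> = (norm x)\<^sup>2 - (\<Sum>e\<in>F. (x \<bullet> e)\<^sup>2) + (\<Sum>e\<in>F. (x \<bullet> e - c e)\<^sup>2)"
    by (simp add: inner_sum_right sum.distrib sum_distrib_left power2_eq_square algebra_simps
        sum_subtractf)
  finally show ?thesis .
qed

lemma bessel:
  fixes x :: "'a::real_inner"
  assumes "orthonormal_set B" "finite F" "F \<subseteq> B"
  shows "(\<Sum>e\<in>F. (x \<bullet> e)\<^sup>2) \<le> (norm x)\<^sup>2"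
  using orthonormal_residual[OF assms, of x "\<lambda>e. x \<bullet> e"] by simp (metis diff_ge_0_iff_ge zero_le_power2)

lemma parseval:
  fixes x :: "'a::real_inner"
  assumes "orthonormal_basis B"
  shows "((\<lambda>e. (x \<bullet> e)\<^sup>2) has_sum (norm x)\<^sup>2) B"
proof -
  have B: "orthonormal_set B" "closure (span B) = UNIV"
    using assms by (auto simp: orthonormal_basis_def)
  have sm: "(\<lambda>e. (x \<bullet> e)\<^sup>2) summable_on B"
    by (rule nonneg_bdd_above_summable_on) (auto intro!: bdd_aboveI bessel[OF B(1)])
  have "infsum (\<lambda>e. (x \<bullet> e)\<^sup>2) B \<le> (norm x)\<^sup>2"
    by (rule infsum_le_finite_sums[OF sm]) (auto intro!: bessel[OF B(1)])
  moreover have "(norm x)\<^sup>2 \<le> infsum (\<lambda>e. (x \<bullet> e)\<^sup>2) B"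
  proof (rule field_le_epsilon)
    fix \<epsilon> :: real assume "0 < \<epsilon>"
    hence "0 < sqrt \<epsilon>" by simp
    moreover have "x \<in> closure (span B)" using B by simp
    ultimately obtain z where z: "z \<in> span B" "dist z x < sqrt \<epsilon>"
      using closure_approachable by blast
    obtain F c where F: "finite F" "F \<subseteq> B" "z = (\<Sum>e\<in>F. c e *\<^sub>R e)"
      using z(1) by (auto simp: span_explicit)
    have "(norm x)\<^sup>2 - (\<Sum>e\<in>F. (x \<bullet> e)\<^sup>2) \<le> (norm (x - z))\<^sup>2"
      using orthonormal_residual[OF B(1) F(1,2), of x c] F(3) by (simp add: sum_nonneg)
    also have "\<dots> \<le> (sqrt \<epsilon>)\<^sup>2" using z(2)
      by (intro power_mono) (auto simp: dist_norm norm_minus_commute)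
    finally have "(norm x)\<^sup>2 \<le> (\<Sum>e\<in>F. (x \<bullet> e)\<^sup>2) + \<epsilon>" using \<open>0 < \<epsilon>\<close> by simp
    also have "(\<Sum>e\<in>F. (x \<bullet> e)\<^sup>2) \<le> infsum (\<lambda>e. (x \<bullet> e)\<^sup>2) B"
      by (rule finite_sum_le_infsum[OF sm F(1,2)]) auto
    finally show "(norm x)\<^sup>2 \<le> infsum (\<lambda>e. (x \<bullet> e)\<^sup>2) B + \<epsilon>" by simp
  qed
  ultimately show ?thesis using has_sum_infsum[OF sm] by simp
qed

lemma has_sum_norm_adj:
  fixes A :: "'a::{real_inner,banach} \<Rightarrow>\<^sub>L 'b::real_inner"
  assumes B: "orthonormal_basis B" and F: "orthonormal_basis F"
    and S: "((\<lambda>e. (norm (A e))\<^sup>2) has_sum s) B"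
  shows "((\<lambda>f. (norm (adj A f))\<^sup>2) has_sum s) F"
proof -
  have 1: "((\<lambda>f. (\<lambda>(e, f). (A e \<bullet> f)\<^sup>2) (e, f)) has_sum (norm (A e))\<^sup>2) F" for e
    using parseval[OF F, of "A e"] by simp
  have "(\<lambda>(e, f). (A e \<bullet> f)\<^sup>2) summable_on (B \<times> F)"
    by (rule summable_on_SigmaI[OF 1]) (use S in \<open>auto simp: summable_on_def\<close>)
  from has_sum_SigmaI[OF 1 S this]
  have "((\<lambda>(f, e). (A e \<bullet> f)\<^sup>2) has_sum s) (F \<times> B)"
    by (subst (asm) has_sum_swap) (simp add: case_prod_unfold)
  moreover have "((\<lambda>e. (\<lambda>(f, e). (A e \<bullet> f)\<^sup>2) (f, e)) has_sum (norm (adj A f))\<^sup>2) B" for f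
    using parseval[OF B, of "adj A f"] by (simp add: adj_inner' inner_commute[of f])
  ultimately show ?thesis by (rule has_sum_SigmaD)
qed


definition hilbert_schmidt :: "('a::real_inner \<Rightarrow>\<^sub>L 'b::real_inner) \<Rightarrow> bool" where
  "hilbert_schmidt A \<longleftrightarrow> (\<exists>B. orthonormal_basis B \<and> (\<lambda>e. (norm (A e))\<^sup>2) summable_on B)"

lemma has_sum_norm_basis_independent:
  fixes A :: "'a::{real_inner,banach} \<Rightarrow>\<^sub>L 'b::{real_inner,banach}"
  assumes "orthonormal_basis B" "orthonormal_basis B'"
    and "((\<lambda>e. (norm (A e))\<^sup>2) has_sum s) B"
  shows "((\<lambda>e. (norm (A e))\<^sup>2) has_sum s) B'"
proof -
  obtain F :: "'b set" where F: "orthonormal_basis F" using orthonormal_basis_exists by blast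
  from has_sum_norm_adj[OF F assms(2) has_sum_norm_adj[OF assms(1) F assms(3)]]
  show ?thesis by simp
qed

lemma hilbert_schmidt_summable:
  fixes A :: "'a::{real_inner,banach} \<Rightarrow>\<^sub>L 'b::{real_inner,banach}"
  assumes "hilbert_schmidt A" "orthonormal_basis B"
  shows "(\<lambda>e. (norm (A e))\<^sup>2) summable_on B"
  using assms has_sum_norm_basis_independent unfolding hilbert_schmidt_def summable_on_def by blast

lemma hilbert_schmidt_adj:
  fixes A :: "'a::{real_inner,banach} \<Rightarrow>\<^sub>L 'b::{real_inner,banach}"
  assumes "hilbert_schmidt A"
  shows "hilbert_schmidt (adj A)"
  using assms has_sum_norm_adj orthonormal_basis_exists
  unfolding hilbert_schmidt_def summable_on_def by metis

lemma hilbert_schmidt_comparison: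
  fixes A B D :: "'a::{real_inner,banach} \<Rightarrow>\<^sub>L 'b::{real_inner,banach}"
  assumes "hilbert_schmidt A" "hilbert_schmidt B"
    and "\<And>e. (norm (blinfun_apply D e))\<^sup>2 \<le> c * (norm (A e))\<^sup>2 + d * (norm (B e))\<^sup>2"
  shows "hilbert_schmidt D"
proof -
  obtain F :: "'a set" where F: "orthonormal_basis F" using orthonormal_basis_exists by blast
  have "(\<lambda>e. c * (norm (A e))\<^sup>2 + d * (norm (B e))\<^sup>2) summable_on F"
    using hilbert_schmidt_summable[OF assms(1) F] hilbert_schmidt_summable[OF assms(2) F]
    by (intro summable_on_add summable_on_cmult_right)
  hence "(\<lambda>e. (norm (D e))\<^sup>2) summable_on F"
    by (rule summable_on_comparison_test) (use assms(3) in auto)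
  thus ?thesis using F hilbert_schmidt_def by blast
qed

lemma le_mult_of_squares: "a\<^sup>2 \<le> b\<^sup>2 * c\<^sup>2 \<Longrightarrow> 0 \<le> b \<Longrightarrow> 0 \<le> c \<Longrightarrow> a \<le> b * c" for a b c :: real
  by (rule power2_le_imp_le) (auto simp: power_mult_distrib)

lemma norm_add_sq_le: "(norm (x + y))\<^sup>2 \<le> 2 * (norm x)\<^sup>2 + 2 * (norm y)\<^sup>2" for x y :: "'a::real_inner"
proof -
  have "0 \<le> (norm (x - y))\<^sup>2" by simp
  thus ?thesis by (simp add: power2_norm_eq_inner algebra_simps inner_commute)
qed

lemma hilbert_schmidt_zero [simp]:
  "hilbert_schmidt (0 :: 'a::{real_inner,banach} \<Rightarrow>\<^sub>L 'b::{real_inner,banach})"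
  using orthonormal_basis_exists[where 'a='a] by (auto simp: hilbert_schmidt_def)

lemma hilbert_schmidt_add:
  fixes A B :: "'a::{real_inner,banach} \<Rightarrow>\<^sub>L 'b::{real_inner,banach}"
  assumes "hilbert_schmidt A" "hilbert_schmidt B"
  shows "hilbert_schmidt (A + B)"
  by (rule hilbert_schmidt_comparison[OF assms, of _ 2 2]) (simp add: plus_blinfun.rep_eq norm_add_sq_le)

lemma hilbert_schmidt_scaleR:
  fixes A :: "'a::{real_inner,banach} \<Rightarrow>\<^sub>L 'b::{real_inner,banach}"
  assumes "hilbert_schmidt A"
  shows "hilbert_schmidt (r *\<^sub>R A)"
  by (rule hilbert_schmidt_comparison[OF assms assms, of _ "r\<^sup>2" 0])
     (simp add: scaleR_blinfun.rep_eq power_mult_distrib)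

lemma hilbert_schmidt_compose_left:
  fixes A :: "'a::{real_inner,banach} \<Rightarrow>\<^sub>L 'b::{real_inner,banach}"
    and D :: "'b \<Rightarrow>\<^sub>L 'c::{real_inner,banach}"
  assumes "hilbert_schmidt A"
  shows "hilbert_schmidt (D o\<^sub>L A)"
proof -
  obtain F :: "'a set" where F: "orthonormal_basis F" using orthonormal_basis_exists by blast
  have "(\<lambda>e. (norm D)\<^sup>2 * (norm (A e))\<^sup>2) summable_on F"
    by (intro summable_on_cmult_right hilbert_schmidt_summable[OF assms F])
  hence "(\<lambda>e. (norm ((D o\<^sub>L A) e))\<^sup>2) summable_on F"
    by (rule summable_on_comparison_test)
       (auto simp flip: power_mult_distrib intro!: power_mono norm_blinfun)
  thus ?thesis using F hilbert_schmidt_def by blast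
qed

lemma hilbert_schmidt_compose_right:
  fixes A :: "'b::{real_inner,banach} \<Rightarrow>\<^sub>L 'c::{real_inner,banach}"
    and D :: "'a::{real_inner,banach} \<Rightarrow>\<^sub>L 'b"
  assumes "hilbert_schmidt A"
  shows "hilbert_schmidt (A o\<^sub>L D)"
  using hilbert_schmidt_adj[OF hilbert_schmidt_compose_left[OF hilbert_schmidt_adj[OF assms], of "adj D"]]
  by (simp add: adj_compose)

text \<open>
  The series is taken over an arbitrarily chosen orthonormal basis.  It is used for
  \<open>A\<^sup>*B\<close> with \<open>A\<close> and \<open>B\<close> Hilbert--Schmidt only, where it does not depend on the basis
  (\<open>hs_inner_has_sum\<close> below).
\<close>

definition op_trace :: "('a::real_inner \<Rightarrow>\<^sub>L 'a) \<Rightarrow> real" where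
  "op_trace T = (\<Sum>\<^sub>\<infinity>e\<in>(SOME B. orthonormal_basis B). e \<bullet> T e)"

lemma has_sum_diff_real:
  fixes f g :: "'a \<Rightarrow> real"
  assumes "(f has_sum a) A" "(g has_sum b) A"
  shows "((\<lambda>x. f x - g x) has_sum a - b) A"
  using has_sum_add[OF assms(1) has_sum_cmult_right[OF assms(2), of "-1"]] by simp

lemma op_trace_adj_has_sum:
  fixes A B :: "'a::{real_inner,banach} \<Rightarrow>\<^sub>L 'b::{real_inner,banach}"
  assumes "hilbert_schmidt A" "hilbert_schmidt B" "orthonormal_basis F"
  shows "((\<lambda>e. A e \<bullet> B e) has_sum op_trace (adj A o\<^sub>L B)) F"
proof -
  let ?G = "SOME B::'a set. orthonormal_basis B"
  have G: "orthonormal_basis ?G" by (rule someI_ex[OF orthonormal_basis_exists])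
  have AB: "hilbert_schmidt (A - B)"
    using hilbert_schmidt_add[OF assms(1) hilbert_schmidt_scaleR[OF assms(2), of "-1"]] by simp
  obtain s t where st: "((\<lambda>e. (norm ((A + B) e))\<^sup>2) has_sum s) ?G"
      "((\<lambda>e. (norm ((A - B) e))\<^sup>2) has_sum t) ?G"
    using hilbert_schmidt_summable[OF hilbert_schmidt_add[OF assms(1,2)] G]
      hilbert_schmidt_summable[OF AB G] unfolding summable_on_def by blast
  have eq: "(\<lambda>e. A e \<bullet> B e) = (\<lambda>e. (1/4) * ((norm ((A + B) e))\<^sup>2 - (norm ((A - B) e))\<^sup>2))"
    by (simp add: fun_eq_iff power2_norm_eq_inner blinfun.bilinear_simps algebra_simps inner_commute)
  have "((\<lambda>e. A e \<bullet> B e) has_sum (1/4) * (s - t)) ?G"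
    unfolding eq by (intro has_sum_cmult_right has_sum_diff_real st)
  hence "op_trace (adj A o\<^sub>L B) = (1/4) * (s - t)"
    unfolding op_trace_def by (intro infsumI) (simp add: adj_inner)
  moreover have "((\<lambda>e. A e \<bullet> B e) has_sum (1/4) * (s - t)) F"
    unfolding eq
    by (intro has_sum_cmult_right has_sum_diff_real has_sum_norm_basis_independent[OF G assms(3)] st)
  ultimately show ?thesis by (simp only:)
qed

typedef (overloaded) ('a::"{real_inner,banach}", 'b::"{real_inner,banach}") hs =
  "{A :: 'a \<Rightarrow>\<^sub>L 'b. hilbert_schmidt A}"
  morphisms hs_op Abs_hs
  by (rule exI[of _ 0]) simp

setup_lifting type_definition_hs

lemma hs_eqI: "hs_op A = hs_op B \<Longrightarrow> A = B" by (simp add: hs_op_inject)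

lemma hilbert_schmidt_hs_op [simp]: "hilbert_schmidt (hs_op A)" using hs_op by simp

instantiation hs :: ("{real_inner,banach}", "{real_inner,banach}") real_vector
begin

lift_definition zero_hs :: "('a, 'b) hs" is 0 by simp
lift_definition plus_hs :: "('a, 'b) hs \<Rightarrow> ('a, 'b) hs \<Rightarrow> ('a, 'b) hs" is "(+)"
  by (rule hilbert_schmidt_add)
lift_definition scaleR_hs :: "real \<Rightarrow> ('a, 'b) hs \<Rightarrow> ('a, 'b) hs" is "(*\<^sub>R)"
  by (rule hilbert_schmidt_scaleR)
lift_definition uminus_hs :: "('a, 'b) hs \<Rightarrow> ('a, 'b) hs" is uminus
  by (metis hilbert_schmidt_scaleR scaleR_minus1_left)
lift_definition minus_hs :: "('a, 'b) hs \<Rightarrow> ('a, 'b) hs \<Rightarrow> ('a, 'b) hs" is "(-)"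
  by (metis hilbert_schmidt_add hilbert_schmidt_scaleR scaleR_minus1_left uminus_add_conv_diff add.commute)

instance
proof
  fix A B D :: "('a, 'b) hs" and r s :: real
  show "A + B + D = A + (B + D)" by transfer simp
  show "A + B = B + A" by transfer simp
  show "0 + A = A" by transfer simp
  show "- A + A = 0" by transfer simp
  show "A - B = A + - B" by transfer simp
  show "r *\<^sub>R (A + B) = r *\<^sub>R A + r *\<^sub>R B" by transfer (simp add: scaleR_add_right)
  show "(r + s) *\<^sub>R A = r *\<^sub>R A + s *\<^sub>R A" by transfer (simp add: scaleR_add_left)
  show "r *\<^sub>R s *\<^sub>R A = (r * s) *\<^sub>R A" by transfer simp
  show "1 *\<^sub>R A = A" by transfer simp
qed

end

instantiation hs :: ("{real_inner,banach}", "{real_inner,banach}") real_inner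
begin

definition inner_hs :: "('a, 'b) hs \<Rightarrow> ('a, 'b) hs \<Rightarrow> real" where
  "inner_hs A B = op_trace (adj (hs_op A) o\<^sub>L hs_op B)"
definition norm_hs :: "('a, 'b) hs \<Rightarrow> real" where
  "norm_hs A = sqrt (inner A A)"
definition dist_hs :: "('a, 'b) hs \<Rightarrow> ('a, 'b) hs \<Rightarrow> real" where
  "dist_hs A B = norm (A - B)"
definition sgn_hs :: "('a, 'b) hs \<Rightarrow> ('a, 'b) hs" where
  "sgn_hs A = A /\<^sub>R norm A"
definition uniformity_hs :: "(('a, 'b) hs \<times> ('a, 'b) hs) filter" where
  "uniformity_hs = (INF e\<in>{0 <..}. principal {(A, B). dist A B < e})"
definition open_hs :: "('a, 'b) hs set \<Rightarrow> bool" where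
  "open_hs U \<longleftrightarrow> (\<forall>A\<in>U. eventually (\<lambda>(A', B). A' = A \<longrightarrow> B \<in> U) uniformity)"

lemma hs_inner_has_sum:
  assumes "orthonormal_basis F"
  shows "((\<lambda>e. hs_op A e \<bullet> hs_op B e) has_sum inner A B) F"
  unfolding inner_hs_def by (rule op_trace_adj_has_sum) (use assms in auto)

instance
proof
  fix A B D :: "('a, 'b) hs" and r s :: real and U :: "('a, 'b) hs set"
  obtain F :: "'a set" where F: "orthonormal_basis F" using orthonormal_basis_exists by blast
  note hs = hs_inner_has_sum[OF F]
  show "dist A B = norm (A - B)" by (rule dist_hs_def)
  show "sgn A = A /\<^sub>R norm A" by (rule sgn_hs_def)
  show "uniformity = (INF e\<in>{0 <..}. principal {(A::('a, 'b) hs, B). dist A B < e})"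
    by (rule uniformity_hs_def)
  show "open U \<longleftrightarrow> (\<forall>A\<in>U. eventually (\<lambda>(A', B). A' = A \<longrightarrow> B \<in> U) uniformity)"
    by (rule open_hs_def)
  show "norm A = sqrt (inner A A)" by (rule norm_hs_def)
  show "inner A B = inner B A"
    using has_sum_unique[OF hs[of A B]] hs[of B A] by (simp add: inner_commute)
  show "inner (A + B) D = inner A D + inner B D"
    by (rule has_sum_unique[OF hs[of "A + B" D]])
       (simp add: plus_hs.rep_eq plus_blinfun.rep_eq inner_add_left has_sum_add hs)
  show "inner (r *\<^sub>R A) B = r * inner A B"
    by (rule has_sum_unique[OF hs[of "r *\<^sub>R A" B]])
       (simp add: scaleR_hs.rep_eq scaleR_blinfun.rep_eq has_sum_cmult_right hs)
  show nn: "0 \<le> inner A A" by (rule has_sum_nonneg[OF hs[of A A]]) simp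
  show "inner A A = 0 \<longleftrightarrow> A = 0"
  proof
    assume "A = 0"
    thus "inner A A = 0" using has_sum_unique[OF hs[of A A]] by (simp add: zero_hs.rep_eq)
  next
    assume 0: "inner A A = 0"
    have "hs_op A e = 0" if "e \<in> F" for e
    proof -
      have "hs_op A e \<bullet> hs_op A e \<le> 0"
        using finite_sum_le_has_sum[OF hs[of A A], of "{e}"] that 0 by auto
      thus ?thesis using inner_gt_zero_iff not_less by blast
    qed
    hence "F \<subseteq> {x. hs_op A x = 0}" by auto
    moreover have "subspace {x. hs_op A x = 0}"
      by (auto simp: subspace_def blinfun.bilinear_simps)
    ultimately have "span F \<subseteq> {x. hs_op A x = 0}" by (rule span_minimal)
    moreover have "closed {x. hs_op A x = 0}"
      by (intro closed_Collect_eq continuous_intros)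
    ultimately have "closure (span F) \<subseteq> {x. hs_op A x = 0}" by (rule closure_minimal)
    hence "hs_op A = 0" using F by (auto simp: orthonormal_basis_def intro!: blinfun_eqI)
    thus "A = 0" by (intro hs_eqI) (simp add: zero_hs.rep_eq)
  qed
qed

end

lemma hs_norm_has_sum:
  assumes "orthonormal_basis F"
  shows "((\<lambda>e. (norm (hs_op A e))\<^sup>2) has_sum (norm A)\<^sup>2) F"
  using hs_inner_has_sum[OF assms, of A A] by (simp add: power2_norm_eq_inner)

lemma norm_hs_op_le: "norm (hs_op A) \<le> norm A"
proof -
  obtain F :: "'a set" where F: "orthonormal_basis F" using orthonormal_basis_exists by blast
  have "norm (adj (hs_op A)) \<le> norm A"
  proof (rule norm_blinfun_bound)
    fix y
    have "((\<lambda>e. (adj (hs_op A) y \<bullet> e)\<^sup>2) has_sum (norm (adj (hs_op A) y))\<^sup>2) F"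
      by (rule parseval[OF F])
    moreover have "((\<lambda>e. (norm (hs_op A e))\<^sup>2 * (norm y)\<^sup>2) has_sum (norm A)\<^sup>2 * (norm y)\<^sup>2) F"
      by (intro has_sum_cmult_left hs_norm_has_sum F)
    moreover have "(adj (hs_op A) y \<bullet> e)\<^sup>2 \<le> (norm (hs_op A e))\<^sup>2 * (norm y)\<^sup>2" for e
      using power_mono[OF Cauchy_Schwarz_ineq2[of y "hs_op A e"], of 2]
      by (simp add: adj_inner' power_mult_distrib mult.commute)
    ultimately have "(norm (adj (hs_op A) y))\<^sup>2 \<le> (norm A)\<^sup>2 * (norm y)\<^sup>2"
      by (rule has_sum_mono)
    thus "norm (adj (hs_op A) y) \<le> norm A * norm y"
      by (rule le_mult_of_squares) auto
  qed simp
  thus ?thesis using norm_adj_le[of "adj (hs_op A)"] by simp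
qed

lemma bounded_linear_hs_op: "bounded_linear hs_op"
  by (rule bounded_linear_intro[of _ 1]) (auto simp: plus_hs.rep_eq scaleR_hs.rep_eq norm_hs_op_le)

instance hs :: ("{real_inner,banach}", "{real_inner,banach}") banach
proof
  fix X :: "nat \<Rightarrow> ('a, 'b) hs" assume X: "Cauchy X"
  obtain F :: "'a set" where F: "orthonormal_basis F" using orthonormal_basis_exists by blast
  have "Cauchy (\<lambda>n. hs_op (X n))"
    by (rule bounded_linear.Cauchy[OF bounded_linear_hs_op X])
  then obtain L where L: "(\<lambda>n. hs_op (X n)) \<longlonglongrightarrow> L"
    using Cauchy_convergent_iff convergent_def by blast
  have *: "\<exists>N. \<forall>n\<ge>N. hilbert_schmidt (hs_op (X n) - L) \<and> norm (Abs_hs (hs_op (X n) - L)) \<le> \<epsilon>"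
    if \<epsilon>: "\<epsilon> > 0" for \<epsilon>
  proof -
    obtain N where N: "\<And>m n. m \<ge> N \<Longrightarrow> n \<ge> N \<Longrightarrow> norm (X m - X n) < \<epsilon>"
      using CauchyD[OF X \<epsilon>] by blast
    have "hilbert_schmidt (hs_op (X n) - L) \<and> norm (Abs_hs (hs_op (X n) - L)) \<le> \<epsilon>" if n: "n \<ge> N" for n
    proof -
      have fin: "(\<Sum>e\<in>G. (norm ((hs_op (X n) - L) e))\<^sup>2) \<le> \<epsilon>\<^sup>2" if G: "finite G" "G \<subseteq> F" for G
      proof (rule LIMSEQ_le_const2)
        show "(\<lambda>m. \<Sum>e\<in>G. (norm ((hs_op (X n) - hs_op (X m)) e))\<^sup>2)
            \<longlonglongrightarrow> (\<Sum>e\<in>G. (norm ((hs_op (X n) - L) e))\<^sup>2)"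
          by (intro tendsto_intros L)
        have "(\<Sum>e\<in>G. (norm ((hs_op (X n) - hs_op (X m)) e))\<^sup>2) \<le> \<epsilon>\<^sup>2" if "m \<ge> N" for m
        proof -
          have "(\<Sum>e\<in>G. (norm (hs_op (X n - X m) e))\<^sup>2) \<le> (norm (X n - X m))\<^sup>2"
            by (rule finite_sum_le_has_sum[OF hs_norm_has_sum[OF F] G]) simp
          also have "\<dots> \<le> \<epsilon>\<^sup>2" using N[OF n that] by (intro power_mono) auto
          finally show ?thesis by (simp add: minus_hs.rep_eq)
        qed
        thus "\<exists>N. \<forall>m\<ge>N. (\<Sum>e\<in>G. (norm ((hs_op (X n) - hs_op (X m)) e))\<^sup>2) \<le> \<epsilon>\<^sup>2" by blast
      qed
      have "(\<lambda>e. (norm ((hs_op (X n) - L) e))\<^sup>2) summable_on F"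
        by (rule nonneg_bdd_above_summable_on) (auto intro!: bdd_aboveI fin)
      hence hs: "hilbert_schmidt (hs_op (X n) - L)" using F hilbert_schmidt_def by blast
      have "(norm (Abs_hs (hs_op (X n) - L)))\<^sup>2 \<le> \<epsilon>\<^sup>2"
        by (rule has_sum_le_finite_sums[OF hs_norm_has_sum[OF F]])
           (use fin hs in \<open>auto simp: Abs_hs_inverse\<close>)
      thus ?thesis using hs \<epsilon> power2_le_imp_le by fastforce
    qed
    thus ?thesis by blast
  qed
  obtain n where n: "hilbert_schmidt (hs_op (X n) - L)" using *[of 1] by auto
  have "L = hs_op (X n) + (-1) *\<^sub>R (hs_op (X n) - L)" by simp
  hence hsL: "hilbert_schmidt L"
    using hilbert_schmidt_add[OF hilbert_schmidt_hs_op hilbert_schmidt_scaleR[OF n]] by metis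
  have eq: "Abs_hs (hs_op (X n) - L) = X n - Abs_hs L" if "hilbert_schmidt (hs_op (X n) - L)" for n
    by (rule hs_eqI) (use hsL that in \<open>simp add: minus_hs.rep_eq Abs_hs_inverse\<close>)
  have "X \<longlonglongrightarrow> Abs_hs L"
  proof (rule LIMSEQ_I)
    fix r :: real assume "0 < r"
    then obtain N where N: "\<And>n. n \<ge> N \<Longrightarrow>
        hilbert_schmidt (hs_op (X n) - L) \<and> norm (Abs_hs (hs_op (X n) - L)) \<le> r / 2"
      using *[of "r/2"] by auto
    have "norm (X n - Abs_hs L) < r" if "n \<ge> N" for n
      using N[OF that] eq[of n] \<open>0 < r\<close> by simp
    thus "\<exists>no. \<forall>n\<ge>no. norm (X n - Abs_hs L) < r" by blast
  qed
  thus "convergent X" by (rule convergentI)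
qed

lift_definition rank_one :: "'b::real_normed_vector \<Rightarrow> 'a::real_inner \<Rightarrow> ('a \<Rightarrow>\<^sub>L 'b)" is
  "\<lambda>y x v. (x \<bullet> v) *\<^sub>R y"
  by (intro bounded_linear_intros)

lemma hilbert_schmidt_rank_one:
  fixes y :: "'b::real_inner" and x :: "'a::{real_inner,banach}"
  shows "hilbert_schmidt (rank_one y x)"
proof -
  obtain F :: "'a set" where F: "orthonormal_basis F" using orthonormal_basis_exists by blast
  have "(\<lambda>e. (x \<bullet> e)\<^sup>2 * (norm y)\<^sup>2) summable_on F"
    by (intro summable_on_cmult_left has_sum_imp_summable[OF parseval[OF F]])
  thus ?thesis using F by (auto simp: hilbert_schmidt_def rank_one.rep_eq power_mult_distrib)
qed

lift_definition rank_one_hs :: "'b::{real_inner,banach} \<Rightarrow> 'a::{real_inner,banach} \<Rightarrow> ('a, 'b) hs"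
  is rank_one by (rule hilbert_schmidt_rank_one)

lemma inner_rank_one_hs:
  fixes x x' :: "'a::{real_inner,banach}" and y y' :: "'b::{real_inner,banach}"
  shows "rank_one_hs y x \<bullet> rank_one_hs y' x' = (y \<bullet> y') * (x \<bullet> x')"
proof -
  obtain F :: "'a set" where F: "orthonormal_basis F" using orthonormal_basis_exists by blast
  have "((\<lambda>e. (1/4) * (((x + x') \<bullet> e)\<^sup>2 - ((x - x') \<bullet> e)\<^sup>2)) has_sum
      (1/4) * ((norm (x + x'))\<^sup>2 - (norm (x - x'))\<^sup>2)) F"
    by (intro has_sum_cmult_right has_sum_diff_real parseval F)
  also have "(1/4) * ((norm (x + x'))\<^sup>2 - (norm (x - x'))\<^sup>2) = x \<bullet> x'"
    by (simp add: power2_norm_eq_inner algebra_simps inner_commute)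
  also have "(\<lambda>e. (1/4) * (((x + x') \<bullet> e)\<^sup>2 - ((x - x') \<bullet> e)\<^sup>2)) = (\<lambda>e. (x \<bullet> e) * (x' \<bullet> e))"
    by (simp add: fun_eq_iff power2_eq_square algebra_simps)
  finally have "((\<lambda>e. (y \<bullet> y') * ((x \<bullet> e) * (x' \<bullet> e))) has_sum (y \<bullet> y') * (x \<bullet> x')) F"
    by (rule has_sum_cmult_right)
  moreover have "((\<lambda>e. (y \<bullet> y') * ((x \<bullet> e) * (x' \<bullet> e))) has_sum
      rank_one_hs y x \<bullet> rank_one_hs y' x') F"
    using hs_inner_has_sum[OF F, of "rank_one_hs y x" "rank_one_hs y' x'"]
    by (simp add: rank_one_hs.rep_eq rank_one.rep_eq mult_ac)
  ultimately show ?thesis using has_sum_unique by blast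
qed

lift_definition right_comp :: "('a \<Rightarrow>\<^sub>L 'a) \<Rightarrow>
    ('a::real_normed_vector \<Rightarrow>\<^sub>L 'b::real_normed_vector) \<Rightarrow>\<^sub>L ('a \<Rightarrow>\<^sub>L 'b)" is
  "\<lambda>C \<theta>. \<theta> o\<^sub>L C"
  by (intro bounded_linear_intros)

lift_definition hs_compose :: "('a::{real_inner,banach}, 'b::{real_inner,banach}) hs \<Rightarrow>
    ('a \<Rightarrow>\<^sub>L 'a) \<Rightarrow> ('a, 'b) hs" is "(o\<^sub>L)"
  by (rule hilbert_schmidt_compose_right)

lemma norm_hs_compose_le: "norm (hs_compose \<theta> C) \<le> norm \<theta> * norm C"
proof -
  obtain F :: "'a set" where F: "orthonormal_basis F" using orthonormal_basis_exists by blast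
  obtain G :: "'b set" where G: "orthonormal_basis G" using orthonormal_basis_exists by blast
  have "((\<lambda>f. (norm (adj (hs_op \<theta> o\<^sub>L C) f))\<^sup>2) has_sum (norm (hs_compose \<theta> C))\<^sup>2) G"
    using has_sum_norm_adj[OF F G hs_norm_has_sum[OF F, of "hs_compose \<theta> C"]]
    by (simp add: hs_compose.rep_eq)
  moreover have "((\<lambda>f. (norm (adj (hs_op \<theta>) f))\<^sup>2 * (norm C)\<^sup>2) has_sum (norm \<theta>)\<^sup>2 * (norm C)\<^sup>2) G"
    by (intro has_sum_cmult_left has_sum_norm_adj[OF F G] hs_norm_has_sum F)
  moreover have "(norm (adj (hs_op \<theta> o\<^sub>L C) f))\<^sup>2 \<le> (norm (adj (hs_op \<theta>) f))\<^sup>2 * (norm C)\<^sup>2" for f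
  proof -
    have "norm (adj C (adj (hs_op \<theta>) f)) \<le> norm (adj C) * norm (adj (hs_op \<theta>) f)"
      by (rule norm_blinfun)
    also have "\<dots> \<le> norm C * norm (adj (hs_op \<theta>) f)"
      by (intro mult_right_mono norm_adj_le) auto
    finally show ?thesis
      using power_mono[of _ _ 2] by (fastforce simp: adj_compose power_mult_distrib mult.commute)
  qed
  ultimately have "(norm (hs_compose \<theta> C))\<^sup>2 \<le> (norm \<theta>)\<^sup>2 * (norm C)\<^sup>2" by (rule has_sum_mono)
  thus ?thesis by (rule le_mult_of_squares) auto
qed

lift_definition right_comp_hs :: "('a \<Rightarrow>\<^sub>L 'a) \<Rightarrow>
    ('a::{real_inner,banach}, 'b::{real_inner,banach}) hs \<Rightarrow>\<^sub>L ('a, 'b) hs" is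
  "\<lambda>C \<theta>. hs_compose \<theta> C"
proof (rule bounded_linear_intro)
  fix C and \<theta> \<eta> :: "('a, 'b) hs" and r
  show "hs_compose (\<theta> + \<eta>) C = hs_compose \<theta> C + hs_compose \<eta> C"
    by transfer (rule bounded_bilinear.add_left[OF bounded_bilinear_blinfun_compose])
  show "hs_compose (r *\<^sub>R \<theta>) C = r *\<^sub>R hs_compose \<theta> C"
    by transfer (rule bounded_bilinear.scaleR_left[OF bounded_bilinear_blinfun_compose])
  show "norm (hs_compose \<theta> C) \<le> norm \<theta> * norm C" by (rule norm_hs_compose_le)
qed

lemma bounded_linear_orthogonal_projection:
  fixes E :: "'a::{real_inner,banach} set"
  assumes E: "subspace E" "closed E"
  defines "P \<equiv> \<lambda>x. THE p. p \<in> E \<and> (\<forall>z\<in>E. (x - p) \<bullet> z = 0)"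
  shows "bounded_linear P"
    and "P x \<in> E" and "z \<in> E \<Longrightarrow> (x - P x) \<bullet> z = 0"
proof -
  have uniq: "p = q" if "p \<in> E" "q \<in> E" "\<forall>z\<in>E. (x - p) \<bullet> z = 0" "\<forall>z\<in>E. (x - q) \<bullet> z = 0" for x p q
  proof -
    have "p - q \<in> E" using E(1) that by (simp add: subspace_diff)
    hence "(x - p) \<bullet> (p - q) = 0" "(x - q) \<bullet> (p - q) = 0" using that by auto
    hence "(p - q) \<bullet> (p - q) = 0" by (simp add: inner_diff_left)
    thus ?thesis by simp
  qed
  have P: "P x \<in> E \<and> (\<forall>z\<in>E. (x - P x) \<bullet> z = 0)" for x
    unfolding P_def by (rule theI') (use orthogonal_projection_exists[OF E, of x] uniq in blast)
  have P_eq: "P x = p" if "p \<in> E" "\<forall>z\<in>E. (x - p) \<bullet> z = 0" for x p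
    using uniq[of "P x" p x] P[of x] that by blast
  show "bounded_linear P"
  proof (rule bounded_linear_intro[of _ 1])
    fix x y r
    show "P (x + y) = P x + P y"
    proof (rule P_eq)
      show "P x + P y \<in> E" using P[of x] P[of y] E(1) by (simp add: subspace_add)
      show "\<forall>z\<in>E. (x + y - (P x + P y)) \<bullet> z = 0"
      proof
        fix z assume "z \<in> E"
        hence "(x - P x) \<bullet> z + (y - P y) \<bullet> z = 0" using P[of x] P[of y] by simp
        thus "(x + y - (P x + P y)) \<bullet> z = 0" by (simp add: inner_diff_left inner_add_left)
      qed
    qed
    show "P (r *\<^sub>R x) = r *\<^sub>R P x"
    proof (rule P_eq)
      show "r *\<^sub>R P x \<in> E" using P[of x] E(1) by (simp add: subspace_scale)
      show "\<forall>z\<in>E. (r *\<^sub>R x - r *\<^sub>R P x) \<bullet> z = 0"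
      proof
        fix z assume "z \<in> E"
        hence "r * ((x - P x) \<bullet> z) = 0" using P[of x] by simp
        thus "(r *\<^sub>R x - r *\<^sub>R P x) \<bullet> z = 0" by (simp add: inner_diff_left right_diff_distrib)
      qed
    qed
    have "P x \<bullet> P x = x \<bullet> P x" using P[of x] by (simp add: inner_diff_left)
    hence "norm (P x) * norm (P x) \<le> norm x * norm (P x)"
      using norm_cauchy_schwarz[of x "P x"] by (simp flip: power2_norm_eq_inner add: power2_eq_square)
    thus "norm (P x) \<le> norm x * 1"
      by (cases "norm (P x) = 0") (simp_all add: mult_le_cancel_right)
  qed
  show "P x \<in> E" and "z \<in> E \<Longrightarrow> (x - P x) \<bullet> z = 0" using P[of x] by blast+
qed

definition orth_proj :: "'a::real_inner set \<Rightarrow> 'a \<Rightarrow>\<^sub>L 'a" where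
  "orth_proj E = Blinfun (\<lambda>x. THE p. p \<in> E \<and> (\<forall>z\<in>E. (x - p) \<bullet> z = 0))"

lemma orth_proj:
  fixes E :: "'a::{real_inner,banach} set"
  assumes "subspace E" "closed E"
  shows "orth_proj E x \<in> E" "z \<in> E \<Longrightarrow> (x - orth_proj E x) \<bullet> z = 0"
  unfolding orth_proj_def bounded_linear_Blinfun_apply[OF bounded_linear_orthogonal_projection(1)[OF assms]]
  using bounded_linear_orthogonal_projection(2,3)[OF assms] by blast+

definition compact_op :: "('a::real_normed_vector \<Rightarrow>\<^sub>L 'b::real_normed_vector) \<Rightarrow> bool" where
  "compact_op T \<longleftrightarrow> compact (closure (blinfun_apply T ` cball 0 1))"

text \<open>
  For complex \<open>c\<close> and a bounded operator \<open>T\<close> on a real space \<open>E\<close>, the operator \<open>T - c Id\<close> acts on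
  the complexification of \<open>E\<close>.  A pair \<open>(u, v)\<close> in \<open>E \<times> E\<close> stands for \<open>u + \<i> v\<close>.  The product norm
  is the Hilbert norm of the complexification if \<open>E\<close> is a Hilbert space and induces its topology
  in general, which is what density of ranges refers to.
\<close>

definition cx_scale :: "complex \<Rightarrow> 'a::real_vector \<times> 'a \<Rightarrow> 'a \<times> 'a" where
  "cx_scale c w = (Re c *\<^sub>R fst w - Im c *\<^sub>R snd w, Re c *\<^sub>R snd w + Im c *\<^sub>R fst w)"

definition cx_of :: "'a::zero \<Rightarrow> 'a \<times> 'a" where
  "cx_of v = (v, 0)"

definition cx_shift :: "('a::real_normed_vector \<Rightarrow>\<^sub>L 'a) \<Rightarrow> complex \<Rightarrow> 'a \<times> 'a \<Rightarrow> 'a \<times> 'a" where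
  "cx_shift T c w = map_prod T T w - cx_scale c w"

definition point_spectrum :: "('a::real_normed_vector \<Rightarrow>\<^sub>L 'a) \<Rightarrow> complex set" where
  "point_spectrum T = {c. \<not> inj (cx_shift T c)}"

definition continuous_spectrum :: "('a::real_normed_vector \<Rightarrow>\<^sub>L 'a) \<Rightarrow> complex set" where
  "continuous_spectrum T =
     {c. inj (cx_shift T c) \<and> \<not> surj (cx_shift T c) \<and> closure (range (cx_shift T c)) = UNIV}"

definition residual_spectrum :: "('a::real_normed_vector \<Rightarrow>\<^sub>L 'a) \<Rightarrow> complex set" where
  "residual_spectrum T =
     {c. inj (cx_shift T c) \<and> \<not> surj (cx_shift T c) \<and> closure (range (cx_shift T c)) \<noteq> UNIV}"

definition eigenspace :: "complex \<Rightarrow> ('a::real_normed_vector \<Rightarrow>\<^sub>L 'a) \<Rightarrow> ('a \<times> 'a) set" where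
  "eigenspace c T = {w. cx_shift T c w = 0}"

definition real_eigenspace :: "real \<Rightarrow> ('a::real_normed_vector \<Rightarrow>\<^sub>L 'a) \<Rightarrow> 'a set" where
  "real_eigenspace r T = {v. T v = r *\<^sub>R v}"

lemma eigenspace_of_real: "eigenspace (of_real r) T = real_eigenspace r T \<times> real_eigenspace r T"
  by (auto simp: eigenspace_def real_eigenspace_def cx_shift_def cx_scale_def zero_prod_def)

text \<open>
  Inside the Hilbert space of Hilbert--Schmidt operators, the completion of the span of the
  \<open>y \<otimes> x\<close> with \<open>x \<in> E\<close> is the closure of that span (see \<open>inner_rank_one_hs\<close> for the inner product).
\<close>

definition hs_tensor :: "'a::{real_inner,banach} set \<Rightarrow> ('a, 'b::{real_inner,banach}) hs set" where
  "hs_tensor E = closure (span {rank_one_hs y x | y x. x \<in> E})"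

text \<open>
  The complex bilinear extension of a real bilinear map.  For \<open>f = rank_one\<close> it is not the
  sesquilinear rank-one operator of the complexified Hilbert spaces: it sends an eigenvector \<open>v\<close> of
  \<open>C\<^sup>*\<close> with eigenvalue \<open>c\<close> to an eigenvector of \<open>\<theta> \<mapsto> \<theta> C\<close> with eigenvalue \<open>c\<close>, not its conjugate.
\<close>

definition cx_bilinear :: "('b \<Rightarrow> 'a \<Rightarrow> 'e::real_vector) \<Rightarrow> 'b \<times> 'b \<Rightarrow> 'a \<times> 'a \<Rightarrow> 'e \<times> 'e" where
  "cx_bilinear f y v =
     (f (fst y) (fst v) - f (snd y) (snd v), f (fst y) (snd v) + f (snd y) (fst v))"

text \<open>
  The analogue of \<^term>\<open>hs_tensor\<close> for a complex subspace \<open>E\<close> of the complexification.  As \<open>y\<close>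
  ranges over the whole complexified space, the real span is already a complex subspace.
\<close>

definition cx_hs_tensor ::
    "('a::{real_inner,banach} \<times> 'a) set \<Rightarrow> (('a, 'b::{real_inner,banach}) hs \<times> ('a, 'b) hs) set" where
  "cx_hs_tensor E = closure (span {cx_bilinear rank_one_hs y v | y v. v \<in> E})"

end

theory Submission
  imports Defs
begin

text \<open>
  Write \<open>A\<^sub>C\<close> for \<open>\<theta> \<mapsto> \<theta> C\<close>, where \<open>\<theta>\<close> takes values in \<open>Y\<close>.  Everything rests on
  \<open>(\<theta> C)\<^sup>* = C\<^sup>* \<theta>\<^sup>*\<close>.  For a fixed real vector \<open>y\<close>, the map
  \<open>\<theta> \<mapsto> \<theta>\<^sup>* y\<close>, applied to both components of a pair \<open>\<theta>\<^sub>1 + \<i> \<theta>\<^sub>2\<close>, intertwines \<open>A\<^sub>C - c\<close> with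
  \<open>C\<^sup>* - c\<close> (\<open>adj_eval_cx_shift\<close>).  In the other direction \<open>w \<mapsto> y \<otimes> w\<close> intertwines \<open>C\<^sup>* - c\<close> with
  \<open>A\<^sub>C - c\<close> (\<open>cx_shift_cx_bilinear_rank_one\<close>).  Since the values \<open>\<theta>\<^sup>* y\<close> determine \<open>\<theta>\<close>, injectivity
  passes between the two operators, which gives the point spectra.  On Hilbert--Schmidt operators
  more is true: \<open>\<parallel>\<theta>\<parallel>\<^sup>2\<close> is the sum of \<open>\<parallel>\<theta>\<^sup>* f\<parallel>\<^sup>2\<close> over an orthonormal basis, so lower bounds
  \<open>\<delta> \<parallel>w\<parallel> \<le> \<parallel>(C\<^sup>* - c) w\<parallel>\<close> pass between them as well, with the same \<open>\<delta>\<close>.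

  Density of the range and surjectivity of \<open>T - c\<close> are injectivity and boundedness below of the
  adjoint \<open>T\<^sup>*\<close> minus the conjugate of \<open>c\<close>.  Because the adjoint of \<open>A\<^sub>C\<close> is \<open>A\<^sub>D\<close> for \<open>D = C\<^sup>*\<close>
  (\<open>adj_right_comp_hs\<close>), the two facts above, applied to \<open>D\<close>, transfer the finer parts of the spectrum.

  The eigenspace of \<open>A\<^sub>C\<close> consists of the \<open>\<theta>\<close> all of whose values \<open>\<theta>\<^sup>* y\<close> lie in the
  eigenspace of \<open>C\<^sup>*\<close>.
  It is the closed span of the tensors \<open>y \<otimes> v\<close>, because anything in it orthogonal to all of them
  is orthogonal to \<open>f \<otimes> \<theta>\<^sup>* f\<close>, that is, has \<open>\<theta>\<^sup>* f = 0\<close>.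

  The map \<open>C \<mapsto> A\<^sub>C\<close> is linear and bounded, and it sends the orthogonal projection onto \<open>E\<close> to the
  one onto \<open>Y \<otimes> E\<close>; applied to a spectral series of \<open>C\<close> it yields that of \<open>A\<^sub>C\<close>.  Finally, if \<open>Y\<close>
  has a finite orthonormal basis, \<open>\<theta> C\<close> is a finite sum of tensors \<open>f \<otimes> C\<^sup>* \<theta>\<^sup>* f\<close>, and compactness
  is inherited from \<open>C\<^sup>*\<close>; if \<open>Y\<close> has an infinite one and \<open>C\<^sup>* v \<noteq> 0\<close> for a unit vector \<open>v\<close>, the
  tensors \<open>f \<otimes> C\<^sup>* v\<close> form an infinite separated set in the image of the unit ball.
\<close>

section \<open>Dense range and surjectivity via the adjoint\<close>

lemma closure_range_eq_UNIV_iff_adjoint_inj: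
  fixes T T' :: "'a::{real_inner,banach} \<Rightarrow> 'a"
  assumes T: "linear T" and adjoint: "\<And>x y. T x \<bullet> y = x \<bullet> T' y"
  shows "closure (range T) = UNIV \<longleftrightarrow> (\<forall>y. T' y = 0 \<longrightarrow> y = 0)"
proof
  assume dense: "closure (range T) = UNIV"
  show "\<forall>y. T' y = 0 \<longrightarrow> y = 0"
  proof (intro allI impI)
    fix y assume "T' y = 0"
    hence "range T \<subseteq> {w. w \<bullet> y = 0}" by (auto simp: adjoint)
    moreover have "closed {w. w \<bullet> y = 0}" by (intro closed_Collect_eq continuous_intros)
    ultimately have "closure (range T) \<subseteq> {w. w \<bullet> y = 0}" by (rule closure_minimal)
    hence "y \<in> {w. w \<bullet> y = 0}" by (simp only: dense) blast
    thus "y = 0" by simp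
  qed
next
  assume inj: "\<forall>y. T' y = 0 \<longrightarrow> y = 0"
  have sub: "subspace (closure (range T))"
    by (intro subspace_closure linear_subspace_image T subspace_UNIV)
  have "w \<in> closure (range T)" for w
  proof -
    obtain p where p: "p \<in> closure (range T)" "\<forall>z\<in>closure (range T). (w - p) \<bullet> z = 0"
      using orthogonal_projection_exists[OF sub] by blast
    have "T x \<bullet> (w - p) = 0" for x
      using p(2) closure_subset[of "range T"] by (auto simp: inner_commute)
    hence "T' (w - p) \<bullet> T' (w - p) = 0" by (simp add: adjoint)
    hence "w - p = 0" using inj unfolding inner_eq_zero_iff by blast
    hence "w = p" by simp
    thus ?thesis using p(1) by simp
  qed
  thus "closure (range T) = UNIV" by blast
qed

text \<open>
  If \<open>T\<close> is onto, then every \<open>w = T z\<close> satisfies \<open>\<bar>y \<bullet> w\<bar> = \<bar>T' y \<bullet> z\<bar> \<le> \<parallel>z\<parallel> \<parallel>T' y\<parallel>\<close>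
  with a constant that depends on \<open>w\<close> only; Baire's theorem makes it uniform in \<open>w\<close>.
  Conversely, a lower bound for \<open>T'\<close> makes \<open>T T'\<close> bounded below, since
  \<open>T T' y \<bullet> y = \<parallel>T' y\<parallel>\<^sup>2\<close>; so the range of \<open>T T'\<close> is closed, and nothing is orthogonal to it.
\<close>

lemma surj_iff_adjoint_bounded_below:
  fixes T T' :: "'a::{real_inner,banach} \<Rightarrow> 'a"
  assumes T: "bounded_linear T" and T': "bounded_linear T'"
    and adjoint: "\<And>x y. T x \<bullet> y = x \<bullet> T' y"
  shows "surj T \<longleftrightarrow> (\<exists>\<delta>>0. \<forall>y. \<delta> * norm y \<le> norm (T' y))"
proof
  assume surj: "surj T"
  define F where "F n = {w. \<forall>y. \<bar>y \<bullet> w\<bar> \<le> real n * norm (T' y)}" for n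
  have closed: "closed (F n)" for n
  proof -
    have "F n = (\<Inter>y. {w. \<bar>y \<bullet> w\<bar> \<le> real n * norm (T' y)})" by (auto simp: F_def)
    thus ?thesis by (auto intro!: closed_INT closed_Collect_le continuous_intros)
  qed
  have cover: "\<Union>(range F) = UNIV"
  proof -
    have "\<exists>n. w \<in> F n" for w
    proof -
      obtain z where z: "w = T z" using surj by blast
      obtain n :: nat where n: "norm z \<le> real n" using real_arch_simple by blast
      have "\<bar>y \<bullet> w\<bar> \<le> real n * norm (T' y)" for y
      proof -
        have "\<bar>y \<bullet> w\<bar> = \<bar>z \<bullet> T' y\<bar>" using adjoint[of z y] z by (simp add: inner_commute)
        also have "\<dots> \<le> norm z * norm (T' y)" by (rule Cauchy_Schwarz_ineq2)
        also have "\<dots> \<le> real n * norm (T' y)" using n by (rule mult_right_mono) simp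
        finally show ?thesis .
      qed
      thus ?thesis by (auto simp: F_def)
    qed
    thus ?thesis by blast
  qed
  have "\<exists>n. interior (F n) \<noteq> {}"
  proof (rule ccontr)
    assume "\<nexists>n. interior (F n) \<noteq> {}"
    hence "euclidean interior_of \<Union>(range F) = {}"
      using closed by (intro Baire_category_alt disjI1 completely_metrizable_space_euclidean) auto
    thus False by (simp add: cover)
  qed
  then obtain n w where "w \<in> interior (F n)" by blast
  then obtain r where r: "r > 0" "cball w r \<subseteq> F n" by (meson mem_interior_cball)
  \<comment> \<open>The summand \<open>1\<close> keeps the denominator positive when \<open>n = 0\<close>.\<close>
  define \<delta> where "\<delta> = r / (2 * real n + 1)"
  have "\<delta> * norm y \<le> norm (T' y)" for y
  proof (cases "y = 0")
    case False
    \<comment> \<open>The points \<open>w\<close> and \<open>w + (r / norm y) y\<close> of the ball differ by a vector whose inner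
      product with \<open>y\<close> is \<open>r * norm y\<close>.\<close>
    define u where "u = w + (r / norm y) *\<^sub>R y"
    have "w \<in> F n" "u \<in> F n" using r by (auto simp: u_def dist_norm)
    hence "\<bar>y \<bullet> w\<bar> \<le> real n * norm (T' y)" "\<bar>y \<bullet> u\<bar> \<le> real n * norm (T' y)" by (auto simp: F_def)
    moreover have "y \<bullet> u = y \<bullet> w + r * norm y"
      using False by (simp add: u_def inner_add_right dot_square_norm power2_eq_square)
    ultimately have "r * norm y \<le> 2 * real n * norm (T' y)" by linarith
    also have "\<dots> \<le> (2 * real n + 1) * norm (T' y)" by (intro mult_right_mono) auto
    finally have "r * norm y \<le> (2 * real n + 1) * norm (T' y)" .
    moreover have "0 < 2 * real n + 1" by simp
    ultimately show ?thesis by (simp add: \<delta>_def pos_divide_le_eq mult.commute)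
  qed simp
  moreover have "\<delta> > 0" using r(1) by (simp add: \<delta>_def add_nonneg_pos)
  ultimately show "\<exists>\<delta>>0. \<forall>y. \<delta> * norm y \<le> norm (T' y)" by blast
next
  assume "\<exists>\<delta>>0. \<forall>y. \<delta> * norm y \<le> norm (T' y)"
  then obtain \<delta> where \<delta>: "\<delta> > 0" "\<And>y. \<delta> * norm y \<le> norm (T' y)" by blast
  define S where "S = T \<circ> T'"
  have S: "bounded_linear S" unfolding S_def comp_def by (rule bounded_linear_compose[OF T T'])
  have S_inner: "S y \<bullet> y = (norm (T' y))\<^sup>2" for y
    by (simp add: S_def adjoint power2_norm_eq_inner)
  have below: "\<delta>\<^sup>2 * norm y \<le> norm (S y)" for y
  proof (cases "y = 0")
    case False
    have "\<delta>\<^sup>2 * norm y * norm y = (\<delta> * norm y)\<^sup>2" by (simp add: power2_eq_square)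
    also have "\<dots> \<le> (norm (T' y))\<^sup>2" using \<delta> by (intro power_mono) auto
    also have "\<dots> \<le> norm (S y) * norm y" unfolding S_inner[symmetric] by (rule norm_cauchy_schwarz)
    finally show ?thesis using False by simp
  qed simp
  have "complete (range S)"
    by (rule complete_isometric_image[of "\<delta>\<^sup>2"]) (use \<delta>(1) below S in \<open>auto simp: complete_UNIV\<close>)
  hence "closed (range S)" by (rule complete_imp_closed)
  moreover have "subspace (range S)"
    using S by (intro linear_subspace_image subspace_UNIV) (rule bounded_linear.linear)
  ultimately have proj: "\<exists>p\<in>range S. \<forall>z\<in>range S. (w - p) \<bullet> z = 0" for w
    by (intro orthogonal_projection_exists)
  have "w \<in> range T" for w
  proof -
    obtain p where p: "p \<in> range S" "\<forall>z\<in>range S. (w - p) \<bullet> z = 0" using proj by blast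
    have "(w - p) \<bullet> S (w - p) = 0" using p(2) by blast
    hence "(norm (T' (w - p)))\<^sup>2 = 0" unfolding S_inner[symmetric] by (simp only: inner_commute)
    moreover have "\<delta> * norm (w - p) \<le> norm (T' (w - p))" by (rule \<delta>(2))
    ultimately have "\<delta> * norm (w - p) \<le> 0" by simp
    hence "w = p" using \<delta>(1) by (simp add: mult_le_0_iff)
    thus ?thesis using p(1) by (auto simp: S_def)
  qed
  thus "surj T" by blast
qed

lemma linear_cx_shift: "linear (cx_shift T c)"
  by (rule linearI)
     (auto simp: cx_shift_def cx_scale_def map_prod_def case_prod_unfold prod_eq_iff
        blinfun.bilinear_simps algebra_simps)

lemma bounded_linear_cx_shift: "bounded_linear (cx_shift T c)"
proof -
  have eq: "cx_shift T c =
      (\<lambda>w. (T (fst w) - (Re c *\<^sub>R fst w - Im c *\<^sub>R snd w), T (snd w) - (Re c *\<^sub>R snd w + Im c *\<^sub>R fst w)))"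
    by (auto simp: fun_eq_iff cx_shift_def cx_scale_def)
  show ?thesis unfolding eq
    by (intro bounded_linear_Pair bounded_linear_sub bounded_linear_add bounded_linear_fst
        bounded_linear_snd bounded_linear_compose[OF bounded_linear_scaleR_right]
        bounded_linear_compose[OF blinfun.bounded_linear_right])
qed

text \<open>
  The inner product of \<open>E \<times> E\<close> is the real part of the one of the complexification, for which the
  adjoint of multiplication by \<open>c\<close> is multiplication by its conjugate.
\<close>

lemma cx_shift_inner_adj:
  "cx_shift T c w \<bullet> z = w \<bullet> cx_shift (adj T) (cnj c) z" for T :: "'a::{real_inner,banach} \<Rightarrow>\<^sub>L 'a"
  by (cases w; cases z)
     (simp add: cx_shift_def cx_scale_def inner_diff_left inner_diff_right inner_add_left
        inner_add_right adj_inner)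

lemma inj_cx_shift_iff: "inj (cx_shift T c) \<longleftrightarrow> (\<forall>w. cx_shift T c w = 0 \<longrightarrow> w = 0)"
  by (rule linear_injective_0[OF linear_cx_shift])

lemma closure_range_cx_shift_iff:
  fixes T :: "'a::{real_inner,banach} \<Rightarrow>\<^sub>L 'a"
  shows "closure (range (cx_shift T c)) = UNIV \<longleftrightarrow> inj (cx_shift (adj T) (cnj c))"
  unfolding inj_cx_shift_iff
  by (rule closure_range_eq_UNIV_iff_adjoint_inj[OF linear_cx_shift cx_shift_inner_adj])

lemma surj_cx_shift_iff:
  fixes T :: "'a::{real_inner,banach} \<Rightarrow>\<^sub>L 'a"
  shows "surj (cx_shift T c) \<longleftrightarrow>
    (\<exists>\<delta>>0. \<forall>w. \<delta> * norm w \<le> norm (cx_shift (adj T) (cnj c) w))"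
  by (rule surj_iff_adjoint_bounded_below[OF bounded_linear_cx_shift bounded_linear_cx_shift
        cx_shift_inner_adj])

section \<open>Evaluating the adjoint of an operator at a vector\<close>

lemma adj_add: "adj (A + B) = adj A + adj B" for A B :: "'a::{real_inner,banach} \<Rightarrow>\<^sub>L 'b::real_inner"
  by (rule adj_unique) (simp add: blinfun.bilinear_simps inner_add_left inner_add_right adj_inner)

lemma adj_diff: "adj (A - B) = adj A - adj B" for A B :: "'a::{real_inner,banach} \<Rightarrow>\<^sub>L 'b::real_inner"
  by (rule adj_unique) (simp add: blinfun.bilinear_simps inner_diff_left inner_diff_right adj_inner)

lemma adj_scaleR: "adj (r *\<^sub>R A) = r *\<^sub>R adj A" for A :: "'a::{real_inner,banach} \<Rightarrow>\<^sub>L 'b::real_inner"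
  by (rule adj_unique) (simp add: blinfun.bilinear_simps adj_inner)

lemma adj_zero [simp]: "adj (0 :: 'a::{real_inner,banach} \<Rightarrow>\<^sub>L 'b::real_inner) = 0"
  using adj_scaleR[of 0 "0 :: 'a \<Rightarrow>\<^sub>L 'b"] by simp

lemma adj_rank_one:
  "adj (rank_one y x) z = (y \<bullet> z) *\<^sub>R x" for x :: "'a::{real_inner,banach}" and y :: "'b::real_inner"
  by (rule vector_eq_ldot[THEN iffD1]) (simp add: rank_one.rep_eq inner_commute flip: adj_inner)

definition adj_eval :: "('a::real_inner \<Rightarrow>\<^sub>L 'b::real_inner) \<times> ('a \<Rightarrow>\<^sub>L 'b) \<Rightarrow> 'b \<Rightarrow> 'a \<times> 'a" where
  "adj_eval \<theta> y = (adj (fst \<theta>) y, adj (snd \<theta>) y)"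

text \<open>
  Since \<open>(\<theta> C)\<^sup>* = C\<^sup>* \<theta>\<^sup>*\<close>, evaluation of adjoints at a fixed real vector intertwines \<open>\<theta> \<mapsto> \<theta> C\<close> with \<open>C\<^sup>*\<close>.  The two components are transposed, not
  conjugated, which is why the same \<open>c\<close> appears on both sides.
\<close>

lemma adj_eval_cx_shift:
  fixes C :: "'a::{real_inner,banach} \<Rightarrow>\<^sub>L 'a" and \<theta> :: "('a \<Rightarrow>\<^sub>L 'b::{real_inner,banach}) \<times> ('a \<Rightarrow>\<^sub>L 'b)"
  shows "adj_eval (cx_shift (right_comp C) c \<theta>) y = cx_shift (adj C) c (adj_eval \<theta> y)"
  by (cases \<theta>)
     (simp add: adj_eval_def cx_shift_def cx_scale_def right_comp.rep_eq adj_add adj_diff adj_scaleR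
       adj_compose blinfun.bilinear_simps)

lemma adj_eval_eq_0_imp:
  fixes \<theta> :: "('a::{real_inner,banach} \<Rightarrow>\<^sub>L 'b::{real_inner,banach}) \<times> ('a \<Rightarrow>\<^sub>L 'b)"
  assumes "\<And>y. adj_eval \<theta> y = 0"
  shows "\<theta> = 0"
proof -
  have "adj (fst \<theta>) = 0" "adj (snd \<theta>) = 0"
    using assms by (auto simp: adj_eval_def zero_prod_def intro!: blinfun_eqI)
  hence "adj (adj (fst \<theta>)) = 0" "adj (adj (snd \<theta>)) = 0" by (simp_all only: adj_zero)
  thus ?thesis by (simp add: prod_eq_iff)
qed

lemma adj_eval_zero [simp]:
  "adj_eval (0 :: ('a::{real_inner,banach} \<Rightarrow>\<^sub>L 'b::real_inner) \<times> ('a \<Rightarrow>\<^sub>L 'b)) y = 0"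
  by (simp add: adj_eval_def zero_prod_def)

lemma eigenspace_right_comp_iff:
  fixes C :: "'a::{real_inner,banach} \<Rightarrow>\<^sub>L 'a" and \<theta> :: "('a \<Rightarrow>\<^sub>L 'b::{real_inner,banach}) \<times> ('a \<Rightarrow>\<^sub>L 'b)"
  shows "\<theta> \<in> eigenspace c (right_comp C) \<longleftrightarrow> (\<forall>y. adj_eval \<theta> y \<in> eigenspace c (adj C))"
  unfolding eigenspace_def mem_Collect_eq adj_eval_cx_shift[symmetric]
  
  using adj_eval_eq_0_imp[of "cx_shift (right_comp C) c \<theta>"] by auto

section \<open>Tensors and the complexified rank-one map\<close>

lemma rank_one_compose:
  fixes x :: "'a::{real_inner,banach}" and y :: "'b::real_normed_vector" and C :: "'a \<Rightarrow>\<^sub>L 'a"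
  shows "rank_one y x o\<^sub>L C = rank_one y (adj C x)"
  by (rule blinfun_eqI) (simp add: rank_one.rep_eq adj_inner')

lemma rank_one_diff_right: "rank_one y (x - x') = rank_one y x - rank_one y x'"
  and rank_one_add_right: "rank_one y (x + x') = rank_one y x + rank_one y x'"
  and rank_one_scaleR_right: "rank_one y (r *\<^sub>R x) = r *\<^sub>R rank_one y x"
  by (rule blinfun_eqI; simp add: rank_one.rep_eq blinfun.bilinear_simps inner_add_left
      inner_diff_left scaleR_left.add scaleR_left.diff scaleR_right_distrib scaleR_right_diff_distrib)+

lemma cx_shift_cx_bilinear_rank_one:
  fixes C :: "'a::{real_inner,banach} \<Rightarrow>\<^sub>L 'a" and y :: "'b::{real_inner,banach} \<times> 'b"
  shows "cx_shift (right_comp C) c (cx_bilinear rank_one y v)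
    = cx_bilinear rank_one y (cx_shift (adj C) c v)"
  by (cases y; cases v)
     (simp add: cx_shift_def cx_scale_def cx_bilinear_def right_comp.rep_eq 
       bounded_bilinear.add_left[OF bounded_bilinear_blinfun_compose]
       bounded_bilinear.diff_left[OF bounded_bilinear_blinfun_compose] rank_one_compose
       rank_one_diff_right rank_one_add_right rank_one_scaleR_right algebra_simps)

lemma cx_bilinear_rank_one_zero_right:
  fixes y :: "'b::real_normed_vector \<times> 'b"
  shows "cx_bilinear rank_one y (0 :: 'a::real_inner \<times> 'a) = 0"
proof -
  have "rank_one z (0 :: 'a) = 0" for z :: 'b by (rule blinfun_eqI) (simp add: rank_one.rep_eq)
  thus ?thesis by (simp add: cx_bilinear_def zero_prod_def)
qed

text \<open>
  With \<open>y = a + \<i> b\<close> and \<open>w = u + \<i> v\<close>, the two components say \<open>a \<otimes> u = b \<otimes> v\<close> and \<open>a \<otimes> v = - b \<otimes> u\<close>.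
  Evaluating adjoints at \<open>a\<close> and at \<open>b\<close> and adding gives \<open>(\<parallel>a\<parallel>\<^sup>2 + \<parallel>b\<parallel>\<^sup>2) u = 0\<close>, and likewise for \<open>v\<close>.
\<close>

lemma cx_bilinear_rank_one_eq_0_imp:
  fixes w :: "'a::{real_inner,banach} \<times> 'a" and y :: "'b::{real_inner,banach} \<times> 'b"
  assumes "cx_bilinear rank_one y w = 0" "y \<noteq> 0"
  shows "w = 0"
proof -
  obtain a b u v where yw: "y = (a, b)" "w = (u, v)" by fastforce
  have "adj (rank_one a u) z = adj (rank_one b v) z" "adj (rank_one a v) z = - adj (rank_one b u) z" for z
    using assms(1) by (auto simp: yw cx_bilinear_def zero_prod_def eq_neg_iff_add_eq_0 adj_add[symmetric]
        simp flip: blinfun.add_left)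
  hence *: "(a \<bullet> z) *\<^sub>R u = (b \<bullet> z) *\<^sub>R v" "(a \<bullet> z) *\<^sub>R v = - ((b \<bullet> z) *\<^sub>R u)" for z
    by (simp_all add: adj_rank_one)
  have "(a \<bullet> a + b \<bullet> b) *\<^sub>R u = 0" "(a \<bullet> a + b \<bullet> b) *\<^sub>R v = 0"
    using *[of a] *[of b] by (simp_all add: scaleR_add_left inner_commute)
  moreover have "a \<bullet> a + b \<bullet> b \<noteq> 0"
    using assms(2) by (auto simp: yw zero_prod_def add_nonneg_eq_0_iff)
  ultimately show ?thesis by (simp add: yw zero_prod_def)
qed

section \<open>Hilbert--Schmidt operators through their adjoints\<close>

lemma parseval_inner:
  fixes x y :: "'a::real_inner"
  assumes "orthonormal_basis B"
  shows "((\<lambda>e. (x \<bullet> e) * (y \<bullet> e)) has_sum x \<bullet> y) B"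
proof -
  have "((\<lambda>e. (1/4) * (((x + y) \<bullet> e)\<^sup>2 - ((x - y) \<bullet> e)\<^sup>2)) has_sum
      (1/4) * ((norm (x + y))\<^sup>2 - (norm (x - y))\<^sup>2)) B"
    by (intro has_sum_cmult_right has_sum_diff_real parseval assms)
  also have "(1/4) * ((norm (x + y))\<^sup>2 - (norm (x - y))\<^sup>2) = x \<bullet> y"
    by (simp add: power2_norm_eq_inner algebra_simps inner_commute)
  also have "(\<lambda>e. (1/4) * (((x + y) \<bullet> e)\<^sup>2 - ((x - y) \<bullet> e)\<^sup>2)) = (\<lambda>e. (x \<bullet> e) * (y \<bullet> e))"
    by (simp add: fun_eq_iff power2_eq_square algebra_simps)
  finally show ?thesis .
qed

lemma hs_norm_adj_has_sum:
  fixes A :: "('a::{real_inner,banach}, 'b::{real_inner,banach}) hs"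
  assumes "orthonormal_basis G"
  shows "((\<lambda>f. (norm (adj (hs_op A) f))\<^sup>2) has_sum (norm A)\<^sup>2) G"
proof -
  obtain F :: "'a set" where F: "orthonormal_basis F" using orthonormal_basis_exists by blast
  show ?thesis by (rule has_sum_norm_adj[OF F assms hs_norm_has_sum[OF F]])
qed

lemma hs_inner_adj_has_sum:
  fixes A B :: "('a::{real_inner,banach}, 'b::{real_inner,banach}) hs"
  assumes "orthonormal_basis G"
  shows "((\<lambda>f. adj (hs_op A) f \<bullet> adj (hs_op B) f) has_sum A \<bullet> B) G"
proof -
  have "((\<lambda>f. (1/4) * ((norm (adj (hs_op (A + B)) f))\<^sup>2 - (norm (adj (hs_op (A - B)) f))\<^sup>2)) has_sum
      (1/4) * ((norm (A + B))\<^sup>2 - (norm (A - B))\<^sup>2)) G"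
    by (intro has_sum_cmult_right has_sum_diff_real hs_norm_adj_has_sum assms)
  thus ?thesis
    by (simp add: power2_norm_eq_inner plus_hs.rep_eq minus_hs.rep_eq adj_add adj_diff
        blinfun.bilinear_simps algebra_simps inner_commute)
qed

lemma hs_inner_rank_one:
  fixes A :: "('a::{real_inner,banach}, 'b::{real_inner,banach}) hs"
  shows "A \<bullet> rank_one_hs y x = hs_op A x \<bullet> y"
proof -
  obtain F :: "'a set" where F: "orthonormal_basis F" using orthonormal_basis_exists by blast
  have "((\<lambda>e. (x \<bullet> e) * (hs_op A e \<bullet> y)) has_sum A \<bullet> rank_one_hs y x) F"
    using hs_inner_has_sum[OF F, of A "rank_one_hs y x"]
    by (simp add: rank_one_hs.rep_eq rank_one.rep_eq)
  moreover have "((\<lambda>e. (x \<bullet> e) * (hs_op A e \<bullet> y)) has_sum x \<bullet> adj (hs_op A) y) F"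
    using parseval_inner[OF F, of x "adj (hs_op A) y"] by (simp add: adj_inner')
       (simp add: inner_commute)
  ultimately show ?thesis by (metis has_sum_unique adj_inner)
qed

lemma norm_rank_one_hs: "norm (rank_one_hs y x) = norm y * norm x"
  by (simp add: norm_eq_sqrt_inner inner_rank_one_hs real_sqrt_mult)

lemma adj_right_comp_hs:
  fixes C :: "'a::{real_inner,banach} \<Rightarrow>\<^sub>L 'a"
  shows "adj (right_comp_hs C :: ('a, 'b::{real_inner,banach}) hs \<Rightarrow>\<^sub>L _) = right_comp_hs (adj C)"
proof (rule adj_unique)
  fix \<theta> \<eta> :: "('a, 'b) hs"
  obtain G :: "'b set" where G: "orthonormal_basis G" using orthonormal_basis_exists by blast
  have "adj (hs_op (hs_compose \<theta> C)) f \<bullet> adj (hs_op \<eta>) f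
      = adj (hs_op \<theta>) f \<bullet> adj (hs_op (hs_compose \<eta> (adj C))) f" for f
    by (simp add: hs_compose.rep_eq adj_compose adj_inner')
  thus "right_comp_hs C \<theta> \<bullet> \<eta> = \<theta> \<bullet> right_comp_hs (adj C) \<eta>"
    using hs_inner_adj_has_sum[OF G, of "hs_compose \<theta> C" \<eta>]
      hs_inner_adj_has_sum[OF G, of \<theta> "hs_compose \<eta> (adj C)"]
    by (simp add: right_comp_hs.rep_eq has_sum_unique)
qed

lemma map_hs_op_cx_shift:
  "map_prod hs_op hs_op (cx_shift (right_comp_hs C) c \<theta>)
    = cx_shift (right_comp C) c (map_prod hs_op hs_op \<theta>)"
  by (cases \<theta>)
     (simp add: cx_shift_def cx_scale_def right_comp_hs.rep_eq right_comp.rep_eq hs_compose.rep_eq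
       plus_hs.rep_eq minus_hs.rep_eq scaleR_hs.rep_eq)

lemma map_hs_op_cx_bilinear:
  "map_prod hs_op hs_op (cx_bilinear rank_one_hs y v) = cx_bilinear rank_one y v"
  by (simp add: cx_bilinear_def rank_one_hs.rep_eq plus_hs.rep_eq minus_hs.rep_eq)

lemma map_hs_op_zero: "map_prod hs_op hs_op 0 = 0"
  by (simp add: zero_prod_def zero_hs.rep_eq)

lemma map_hs_op_eq_iff: "map_prod hs_op hs_op \<theta> = map_prod hs_op hs_op \<eta> \<longleftrightarrow> \<theta> = \<eta>"
  by (cases \<theta>; cases \<eta>) (simp add: hs_op_inject)

lemma map_hs_op_eq_0_iff: "map_prod hs_op hs_op \<theta> = 0 \<longleftrightarrow> \<theta> = 0"
  using map_hs_op_eq_iff[of \<theta> 0] by (simp only: map_hs_op_zero)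

lemma eigenspace_right_comp_hs_iff:
  "\<theta> \<in> eigenspace c (right_comp_hs C) \<longleftrightarrow> map_prod hs_op hs_op \<theta> \<in> eigenspace c (right_comp C)"
  by (simp add: eigenspace_def map_hs_op_eq_0_iff flip: map_hs_op_cx_shift)

lemma cx_shift_cx_bilinear_rank_one_hs:
  "cx_shift (right_comp_hs C) c (cx_bilinear rank_one_hs y v)
    = cx_bilinear rank_one_hs y (cx_shift (adj C) c v)"
  by (rule map_hs_op_eq_iff[THEN iffD1])
     (simp only: map_hs_op_cx_shift map_hs_op_cx_bilinear cx_shift_cx_bilinear_rank_one)

lemma norm_cx_bilinear_rank_one_hs:
  fixes y :: "'b::{real_inner,banach}" and w :: "'a::{real_inner,banach} \<times> 'a"
  shows "norm (cx_bilinear rank_one_hs (cx_of y) w) = norm y * norm w"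
proof -
  have "rank_one_hs (0 :: 'b) x = 0" for x :: 'a
    by (rule hs_eqI) (auto simp: rank_one_hs.rep_eq zero_hs.rep_eq rank_one.rep_eq intro!: blinfun_eqI)
  hence "norm (cx_bilinear rank_one_hs (cx_of y) w)
      = sqrt ((norm y * norm (fst w))\<^sup>2 + (norm y * norm (snd w))\<^sup>2)"
    by (simp add: cx_bilinear_def cx_of_def norm_Pair norm_rank_one_hs)
  also have "\<dots> = sqrt ((norm y)\<^sup>2 * ((norm (fst w))\<^sup>2 + (norm (snd w))\<^sup>2))"
    by (simp only: power_mult_distrib distrib_left)
  also have "\<dots> = norm y * norm w" by (simp add: real_sqrt_mult norm_prod_def)
  finally show ?thesis .
qed

lemma norm_adj_eval_has_sum:
  fixes \<theta> :: "('a::{real_inner,banach}, 'b::{real_inner,banach}) hs \<times> ('a, 'b) hs"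
  assumes "orthonormal_basis G"
  shows "((\<lambda>f. (norm (adj_eval (map_prod hs_op hs_op \<theta>) f))\<^sup>2) has_sum (norm \<theta>)\<^sup>2) G"
  by (cases \<theta>) (simp add: adj_eval_def norm_Pair has_sum_add hs_norm_adj_has_sum[OF assms])

section \<open>Comparison of the spectra\<close>

lemma inj_right_comp_iff:
  fixes C :: "'a::{real_inner,banach} \<Rightarrow>\<^sub>L 'a"
  assumes "\<exists>y::'b::{real_inner,banach}. y \<noteq> 0"
  shows "inj (cx_shift (right_comp C :: ('a \<Rightarrow>\<^sub>L 'b) \<Rightarrow>\<^sub>L _) c) \<longleftrightarrow> inj (cx_shift (adj C) c)"
proof
  assume inj: "inj (cx_shift (right_comp C :: ('a \<Rightarrow>\<^sub>L 'b) \<Rightarrow>\<^sub>L _) c)"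
  obtain y :: 'b where y: "cx_of y \<noteq> 0" using assms by (auto simp: cx_of_def zero_prod_def)
  have "w = 0" if "cx_shift (adj C) c w = 0" for w
  proof -
    have "cx_shift (right_comp C) c (cx_bilinear rank_one (cx_of y) w) = 0"
      by (simp add: cx_shift_cx_bilinear_rank_one that cx_bilinear_rank_one_zero_right)
    hence "cx_bilinear rank_one (cx_of y) w = 0" using inj unfolding inj_cx_shift_iff by blast
    thus ?thesis using y by (rule cx_bilinear_rank_one_eq_0_imp)
  qed
  thus "inj (cx_shift (adj C) c)" by (simp add: inj_cx_shift_iff)
next
  assume inj: "inj (cx_shift (adj C) c)"
  have "\<theta> = 0" if "cx_shift (right_comp C) c \<theta> = 0" for \<theta> :: "('a \<Rightarrow>\<^sub>L 'b) \<times> ('a \<Rightarrow>\<^sub>L 'b)"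
  proof (rule adj_eval_eq_0_imp)
    fix y
    have "cx_shift (adj C) c (adj_eval \<theta> y) = 0" using that by (simp flip: adj_eval_cx_shift)
    thus "adj_eval \<theta> y = 0" using inj unfolding inj_cx_shift_iff by blast
  qed
  thus "inj (cx_shift (right_comp C :: ('a \<Rightarrow>\<^sub>L 'b) \<Rightarrow>\<^sub>L _) c)" by (simp add: inj_cx_shift_iff)
qed

lemma inj_right_comp_hs_iff:
  fixes C :: "'a::{real_inner,banach} \<Rightarrow>\<^sub>L 'a"
  assumes "\<exists>y::'b::{real_inner,banach}. y \<noteq> 0"
  shows "inj (cx_shift (right_comp_hs C :: ('a, 'b) hs \<Rightarrow>\<^sub>L _) c) \<longleftrightarrow> inj (cx_shift (adj C) c)"
proof
  assume inj: "inj (cx_shift (right_comp_hs C :: ('a, 'b) hs \<Rightarrow>\<^sub>L _) c)"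
  obtain y :: 'b where y: "y \<noteq> 0" using assms by blast
  have "w = 0" if "cx_shift (adj C) c w = 0" for w
  proof -
    have "norm (cx_shift (right_comp_hs C) c (cx_bilinear rank_one_hs (cx_of y) w)) = 0"
      by (simp only: cx_shift_cx_bilinear_rank_one_hs norm_cx_bilinear_rank_one_hs that) simp
    hence "cx_bilinear rank_one_hs (cx_of y) w = 0" using inj unfolding inj_cx_shift_iff norm_eq_zero by blast
    hence "norm y * norm w = 0" by (simp only: norm_zero flip: norm_cx_bilinear_rank_one_hs)
    thus ?thesis using y by simp
  qed
  thus "inj (cx_shift (adj C) c)" by (simp add: inj_cx_shift_iff)
next
  assume "inj (cx_shift (adj C) c)"
  hence "inj (cx_shift (right_comp C :: ('a \<Rightarrow>\<^sub>L 'b) \<Rightarrow>\<^sub>L _) c)" by (simp add: inj_right_comp_iff[OF assms])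
  thus "inj (cx_shift (right_comp_hs C :: ('a, 'b) hs \<Rightarrow>\<^sub>L _) c)"
    unfolding inj_cx_shift_iff by (metis map_hs_op_cx_shift map_hs_op_eq_0_iff)
qed

text \<open>
  Testing on \<open>y \<otimes> w\<close> gives one direction.  For the other, the bound at each \<open>\<theta>\<^sup>* f\<close> is squared
  and summed over an orthonormal basis of vectors \<open>f\<close>.
\<close>

lemma bounded_below_right_comp_hs_iff:
  fixes C :: "'a::{real_inner,banach} \<Rightarrow>\<^sub>L 'a"
  assumes "\<exists>y::'b::{real_inner,banach}. y \<noteq> 0"
  shows "(\<forall>\<theta> :: ('a, 'b) hs \<times> ('a, 'b) hs. \<delta> * norm \<theta> \<le> norm (cx_shift (right_comp_hs C) c \<theta>))
    \<longleftrightarrow> (\<forall>w. \<delta> * norm w \<le> norm (cx_shift (adj C) c w))"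
    (is "?hs \<longleftrightarrow> ?adj")
proof
  assume hs: ?hs
  obtain y :: 'b where y: "norm y > 0" using assms by auto
  have "\<delta> * norm w \<le> norm (cx_shift (adj C) c w)" for w
  proof -
    have "\<delta> * (norm y * norm w) \<le> norm y * norm (cx_shift (adj C) c w)"
      using hs[THEN spec, of "cx_bilinear rank_one_hs (cx_of y) w"]
      by (simp only: cx_shift_cx_bilinear_rank_one_hs norm_cx_bilinear_rank_one_hs)
    hence "norm y * (\<delta> * norm w) \<le> norm y * norm (cx_shift (adj C) c w)" by (simp add: mult_ac)
    thus ?thesis using y by simp
  qed
  thus ?adj by blast
next
  assume adj: ?adj
  show ?hs
  proof (cases "\<delta> \<le> 0")
    case True
    thus ?thesis using mult_nonpos_nonneg[OF True norm_ge_zero] norm_ge_zero order_trans by blast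
  next
    case False
    obtain G :: "'b set" where G: "orthonormal_basis G" using orthonormal_basis_exists by blast
    show ?thesis
    proof
      fix \<theta> :: "('a, 'b) hs \<times> ('a, 'b) hs"
      let ?ev = "\<lambda>\<theta>. adj_eval (map_prod hs_op hs_op \<theta>)"
      have "((\<lambda>f. \<delta>\<^sup>2 * (norm (?ev \<theta> f))\<^sup>2) has_sum \<delta>\<^sup>2 * (norm \<theta>)\<^sup>2) G"
        by (intro has_sum_cmult_right norm_adj_eval_has_sum G)
      moreover have "((\<lambda>f. (norm (?ev (cx_shift (right_comp_hs C) c \<theta>) f))\<^sup>2) has_sum
          (norm (cx_shift (right_comp_hs C) c \<theta>))\<^sup>2) G"
        by (rule norm_adj_eval_has_sum[OF G])
      moreover have "\<delta>\<^sup>2 * (norm (?ev \<theta> f))\<^sup>2 \<le> (norm (?ev (cx_shift (right_comp_hs C) c \<theta>) f))\<^sup>2" for f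
        unfolding map_hs_op_cx_shift adj_eval_cx_shift power_mult_distrib[symmetric]
        using adj False by (intro power_mono adj[rule_format]) simp_all
      ultimately have "\<delta>\<^sup>2 * (norm \<theta>)\<^sup>2 \<le> (norm (cx_shift (right_comp_hs C) c \<theta>))\<^sup>2"
        by (rule has_sum_mono)
      thus "\<delta> * norm \<theta> \<le> norm (cx_shift (right_comp_hs C) c \<theta>)"
        by (intro power2_le_imp_le[OF _ norm_ge_zero]) (simp only: power_mult_distrib)
    qed
  qed
qed

lemma surj_right_comp_hs_iff:
  fixes C :: "'a::{real_inner,banach} \<Rightarrow>\<^sub>L 'a"
  assumes "\<exists>y::'b::{real_inner,banach}. y \<noteq> 0"
  shows "surj (cx_shift (right_comp_hs C :: ('a, 'b) hs \<Rightarrow>\<^sub>L _) c) \<longleftrightarrow> surj (cx_shift (adj C) c)"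
  unfolding surj_cx_shift_iff adj_right_comp_hs bounded_below_right_comp_hs_iff[OF assms] ..

lemma closure_range_right_comp_hs_iff:
  fixes C :: "'a::{real_inner,banach} \<Rightarrow>\<^sub>L 'a"
  assumes "\<exists>y::'b::{real_inner,banach}. y \<noteq> 0"
  shows "closure (range (cx_shift (right_comp_hs C :: ('a, 'b) hs \<Rightarrow>\<^sub>L _) c)) = UNIV
    \<longleftrightarrow> closure (range (cx_shift (adj C) c)) = UNIV"
  unfolding closure_range_cx_shift_iff adj_right_comp_hs inj_right_comp_hs_iff[OF assms] ..

section \<open>Eigenspaces as tensor products\<close>

text \<open>
  For the inclusion of the eigenspace in the tensor product: an operator pair \<open>\<eta>\<close> in the
  eigenspace and orthogonal to the tensor product is orthogonal to \<open>f \<otimes> w\<close> with \<open>w\<close> the value of \<open>\<eta>\<^sup>*\<close> at \<open>f\<close>, and that inner product is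
  \<open>\<parallel>w\<parallel>\<^sup>2\<close>.
\<close>

lemma eigenspace_right_comp_hs:
  fixes C :: "'a::{real_inner,banach} \<Rightarrow>\<^sub>L 'a"
  shows "eigenspace c (right_comp_hs C :: ('a, 'b::{real_inner,banach}) hs \<Rightarrow>\<^sub>L _)
    = cx_hs_tensor (eigenspace c (adj C))"
    (is "?eig = cx_hs_tensor ?E")
proof
  interpret shift: bounded_linear "cx_shift (right_comp_hs C :: ('a, 'b) hs \<Rightarrow>\<^sub>L _) c"
    by (rule bounded_linear_cx_shift)
  have sub: "subspace ?eig"
    by (auto simp: eigenspace_def subspace_def shift.add shift.scaleR shift.zero)
  have cl: "closed ?eig"
    unfolding eigenspace_def by (intro closed_Collect_eq shift.continuous_on continuous_intros)
  have "cx_bilinear rank_one_hs y v \<in> ?eig" if "v \<in> ?E" for y v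
    using that
    by (simp add: eigenspace_right_comp_hs_iff map_hs_op_cx_bilinear)
       (simp add: eigenspace_def cx_shift_cx_bilinear_rank_one cx_bilinear_rank_one_zero_right)
  hence "{cx_bilinear rank_one_hs y v | y v. v \<in> ?E} \<subseteq> ?eig" by blast
  thus tensor_le: "cx_hs_tensor ?E \<subseteq> ?eig"
    unfolding cx_hs_tensor_def by (intro closure_minimal span_minimal sub cl)
  show "?eig \<subseteq> cx_hs_tensor ?E"
  proof
    fix \<theta> assume \<theta>: "\<theta> \<in> ?eig"
    have "subspace (cx_hs_tensor ?E :: (('a, 'b) hs \<times> ('a, 'b) hs) set)"
         "closed (cx_hs_tensor ?E :: (('a, 'b) hs \<times> ('a, 'b) hs) set)"
      by (simp_all add: cx_hs_tensor_def subspace_closure)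
    then obtain p where p: "p \<in> cx_hs_tensor ?E" "\<forall>z\<in>cx_hs_tensor ?E. (\<theta> - p) \<bullet> z = 0"
      using orthogonal_projection_exists by blast
    define \<eta> where "\<eta> = \<theta> - p"
    have "\<eta> \<in> ?eig" unfolding \<eta>_def using \<theta> p(1) tensor_le by (intro subspace_diff[OF sub]) auto
    have "adj_eval (map_prod hs_op hs_op \<eta>) f = 0" for f
    proof -
      let ?w = "adj_eval (map_prod hs_op hs_op \<eta>) f"
      have "?w \<in> ?E"
        using \<open>\<eta> \<in> ?eig\<close> by (simp add: eigenspace_right_comp_hs_iff eigenspace_right_comp_iff)
      hence "cx_bilinear rank_one_hs (cx_of f) ?w \<in> cx_hs_tensor ?E"
        unfolding cx_hs_tensor_def by (intro subsetD[OF closure_subset] span_base) blast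
      hence "\<eta> \<bullet> cx_bilinear rank_one_hs (cx_of f) ?w = 0" using p(2) by (simp add: \<eta>_def)
      moreover have "\<eta> \<bullet> cx_bilinear rank_one_hs (cx_of f) ?w = ?w \<bullet> ?w"
        by (cases \<eta>)
           (simp add: cx_bilinear_def cx_of_def adj_eval_def hs_inner_rank_one adj_inner
             inner_diff_right inner_add_right)
      ultimately show ?thesis by simp
    qed
    hence "map_prod hs_op hs_op \<eta> = 0" by (rule adj_eval_eq_0_imp)
    hence "\<theta> = p" by (simp add: map_hs_op_eq_0_iff \<eta>_def)
    thus "\<theta> \<in> cx_hs_tensor ?E" using p(1) by simp
  qed
qed

section \<open>Spectral decomposition\<close>

text \<open>
  If \<open>u + \<i> v\<close> is an eigenvector for \<open>c\<close>, then \<open>C u \<bullet> v = u \<bullet> C v\<close> reads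
  \<open>Im c (\<parallel>u\<parallel>\<^sup>2 + \<parallel>v\<parallel>\<^sup>2) = 0\<close>.
\<close>

lemma self_adjoint_point_spectrum_real:
  fixes C :: "'a::{real_inner,banach} \<Rightarrow>\<^sub>L 'a"
  assumes "adj C = C"
  shows "point_spectrum C \<subseteq> \<real>"
proof
  fix c assume "c \<in> point_spectrum C"
  then obtain w where w: "cx_shift C c w = 0" "w \<noteq> 0"
    unfolding point_spectrum_def mem_Collect_eq inj_cx_shift_iff by blast
  obtain u v where uv: "w = (u, v)" by fastforce
  have Cu: "C u = Re c *\<^sub>R u - Im c *\<^sub>R v" and Cv: "C v = Re c *\<^sub>R v + Im c *\<^sub>R u"
    using w(1) by (auto simp: uv cx_shift_def cx_scale_def zero_prod_def)
  have "C u \<bullet> v = u \<bullet> C v" using adj_inner[of C u v] assms by simp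
  hence "Im c * (u \<bullet> u + v \<bullet> v) = 0"
    by (simp add: Cu Cv inner_diff_left inner_add_right algebra_simps)
  moreover have "u \<bullet> u + v \<bullet> v \<noteq> 0"
    using w(2) by (auto simp: uv zero_prod_def add_nonneg_eq_0_iff)
  ultimately show "c \<in> \<real>" by (simp add: complex_is_Real_iff)
qed

lemma subspace_real_eigenspace: "subspace (real_eigenspace r T)"
  by (auto simp: real_eigenspace_def subspace_def blinfun.bilinear_simps algebra_simps)

lemma closed_real_eigenspace: "closed (real_eigenspace r T)"
  unfolding real_eigenspace_def by (intro closed_Collect_eq continuous_intros)

text \<open>
  Both sides fix every \<open>y \<otimes> x\<close> with \<open>x \<in> E\<close>, hence the whole tensor product.  An operator orthogonal
  to all of these vanishes on \<open>E\<close>, so precomposing it with the projection onto \<open>E\<close> gives \<open>0\<close>.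
\<close>

lemma right_comp_hs_orth_proj:
  fixes E :: "'a::{real_inner,banach} set"
  assumes E: "subspace E" "closed E"
  shows "right_comp_hs (orth_proj E) = orth_proj (hs_tensor E :: ('a, 'b::{real_inner,banach}) hs set)"
proof (rule blinfun_eqI)
  fix \<theta> :: "('a, 'b) hs"
  let ?Q = "right_comp_hs (orth_proj E) :: ('a, 'b) hs \<Rightarrow>\<^sub>L ('a, 'b) hs"
  let ?H = "hs_tensor E :: ('a, 'b) hs set"
  have H: "subspace ?H" "closed ?H" by (simp_all add: hs_tensor_def subspace_closure)
  have "?Q (rank_one_hs y x) = rank_one_hs y x" if "x \<in> E" for x and y :: 'b
  proof (rule hs_eqI, rule blinfun_eqI)
    fix v
    have "x \<bullet> orth_proj E v = x \<bullet> v"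
      using orth_proj(2)[OF E that, of v] by (simp add: inner_diff_left inner_diff_right inner_commute)
    thus "hs_op (?Q (rank_one_hs y x)) v = hs_op (rank_one_hs y x) v"
      by (simp add: right_comp_hs.rep_eq hs_compose.rep_eq rank_one_hs.rep_eq rank_one.rep_eq)
  qed
  hence "{rank_one_hs y x | y x. x \<in> E} \<subseteq> {z. ?Q z = z}" by blast
  moreover have "subspace {z. ?Q z = z}" by (auto simp: subspace_def blinfun.bilinear_simps)
  moreover have "closed {z. ?Q z = z}" by (intro closed_Collect_eq continuous_intros)
  ultimately have "?H \<subseteq> {z. ?Q z = z}"
    unfolding hs_tensor_def by (intro closure_minimal span_minimal)
  hence fixed: "?Q (orth_proj ?H \<theta>) = orth_proj ?H \<theta>" using orth_proj(1)[OF H] by blast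
  define \<eta> where "\<eta> = \<theta> - orth_proj ?H \<theta>"
  have "hs_op \<eta> x = 0" if "x \<in> E" for x
  proof -
    have "rank_one_hs y x \<in> ?H" for y :: 'b
      unfolding hs_tensor_def using that by (intro subsetD[OF closure_subset] span_base) blast
    hence "\<eta> \<bullet> rank_one_hs (hs_op \<eta> x) x = 0" unfolding \<eta>_def by (rule orth_proj(2)[OF H])
    thus ?thesis by (simp add: hs_inner_rank_one)
  qed
  hence "?Q \<eta> = 0"
    by (intro hs_eqI blinfun_eqI)
       (simp add: right_comp_hs.rep_eq hs_compose.rep_eq zero_hs.rep_eq orth_proj(1)[OF E])
  thus "?Q \<theta> = orth_proj ?H \<theta>" using fixed by (simp add: \<eta>_def blinfun.bilinear_simps)
qed

lemma bounded_linear_right_comp_hs: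
  "bounded_linear (right_comp_hs :: ('a::{real_inner,banach} \<Rightarrow>\<^sub>L 'a) \<Rightarrow>
     ('a, 'b::{real_inner,banach}) hs \<Rightarrow>\<^sub>L ('a, 'b) hs)"
proof (rule bounded_linear_intro[of _ 1])
  fix C D :: "'a \<Rightarrow>\<^sub>L 'a" and r
  show "(right_comp_hs (C + D) :: ('a, 'b) hs \<Rightarrow>\<^sub>L _) = right_comp_hs C + right_comp_hs D"
    by (intro blinfun_eqI hs_eqI)
       (simp add: right_comp_hs.rep_eq hs_compose.rep_eq plus_blinfun.rep_eq plus_hs.rep_eq blinfun.add_right)
  show "(right_comp_hs (r *\<^sub>R C) :: ('a, 'b) hs \<Rightarrow>\<^sub>L _) = r *\<^sub>R right_comp_hs C"
    by (intro blinfun_eqI hs_eqI)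
       (simp add: right_comp_hs.rep_eq hs_compose.rep_eq scaleR_blinfun.rep_eq scaleR_hs.rep_eq
         blinfun.scaleR_right)
  show "norm (right_comp_hs C :: ('a, 'b) hs \<Rightarrow>\<^sub>L _) \<le> norm C * 1"
    by (intro norm_blinfun_bound)
       (use norm_hs_compose_le in \<open>auto simp: right_comp_hs.rep_eq mult.commute\<close>)
qed

section \<open>Compactness\<close>

lemma finite_orthonormal_basis_expansion:
  assumes G: "orthonormal_basis G" "finite G"
  shows "y = (\<Sum>f\<in>G. (y \<bullet> f) *\<^sub>R f)"
proof -
  have ortho: "orthonormal_set G" using G(1) by (simp add: orthonormal_basis_def)
  have "(\<Sum>f\<in>G. (y \<bullet> f)\<^sup>2) = (norm y)\<^sup>2"
    by (rule has_sum_unique[OF has_sum_finite[OF G(2)] parseval[OF G(1)]])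
  thus ?thesis using orthonormal_residual[OF ortho G(2) order_refl, of y "\<lambda>f. y \<bullet> f"] by simp
qed

lemma right_comp_hs_finite_expansion:
  fixes C :: "'a::{real_inner,banach} \<Rightarrow>\<^sub>L 'a" and \<theta> :: "('a, 'b::{real_inner,banach}) hs"
  assumes G: "orthonormal_basis G" "finite G"
  shows "right_comp_hs C \<theta> = (\<Sum>f\<in>G. rank_one_hs f (adj C (adj (hs_op \<theta>) f)))"
proof (rule hs_eqI, rule blinfun_eqI)
  fix x
  have "hs_op (right_comp_hs C \<theta>) x = (\<Sum>f\<in>G. (hs_op \<theta> (C x) \<bullet> f) *\<^sub>R f)"
    using finite_orthonormal_basis_expansion[OF G, of "hs_op \<theta> (C x)"]
    by (simp add: right_comp_hs.rep_eq hs_compose.rep_eq)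
  also have "\<dots> = hs_op (\<Sum>f\<in>G. rank_one_hs f (adj C (adj (hs_op \<theta>) f))) x"
    by (simp add: linear_sum[OF bounded_linear.linear[OF bounded_linear_hs_op]] blinfun.sum_left
        rank_one_hs.rep_eq rank_one.rep_eq adj_inner')
       (simp add: inner_commute)
  finally show "hs_op (right_comp_hs C \<theta>) x
      = hs_op (\<Sum>f\<in>G. rank_one_hs f (adj C (adj (hs_op \<theta>) f))) x" .
qed

lemma bounded_linear_rank_one_hs:
  "bounded_linear (rank_one_hs y :: 'a::{real_inner,banach} \<Rightarrow> ('a, 'b::{real_inner,banach}) hs)"
  by (rule bounded_linear_intro[of _ "norm y"])
     (auto intro!: hs_eqI simp: rank_one_hs.rep_eq plus_hs.rep_eq scaleR_hs.rep_eq rank_one_add_right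
       rank_one_scaleR_right norm_rank_one_hs)

lemma compact_rank_one_hs_sums:
  fixes K :: "'a::{real_inner,banach} set" and G :: "'b::{real_inner,banach} set"
  assumes "finite G" "compact K"
  shows "\<exists>M. compact M \<and> (\<forall>w. (\<forall>f\<in>G. w f \<in> K) \<longrightarrow> (\<Sum>f\<in>G. rank_one_hs f (w f)) \<in> M)"
  using assms(1)
proof induction
  case empty
  show ?case by (intro exI[of _ "{0}"]) simp
next
  case (insert g G)
  then obtain M where M: "compact M"
    "\<And>w. \<forall>f\<in>G. w f \<in> K \<Longrightarrow> (\<Sum>f\<in>G. rank_one_hs f (w f)) \<in> M" by blast
  have "compact (rank_one_hs g ` K)"
    by (intro compact_continuous_image bounded_linear.continuous_on[OF bounded_linear_rank_one_hs]
        continuous_intros assms)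
  hence "compact {a + b | a b. a \<in> rank_one_hs g ` K \<and> b \<in> M}" using M(1) by (rule compact_sums)
  moreover have "(\<Sum>f\<in>insert g G. rank_one_hs f (w f)) \<in> {a + b | a b. a \<in> rank_one_hs g ` K \<and> b \<in> M}"
    if "\<forall>f\<in>insert g G. w f \<in> K" for w
    using that insert.hyps M(2)[of w] by auto
  ultimately show ?case by blast
qed

text \<open>
  As \<open>\<theta>\<close> runs through the unit ball, each \<open>C\<^sup>* \<theta>\<^sup>* f\<close> stays in the compact closure of the image of
  the unit ball under \<open>C\<^sup>*\<close>, so \<open>\<theta> C\<close> stays in a sum of finitely many compact sets.
\<close>

lemma compact_op_right_comp_hs:
  fixes C :: "'a::{real_inner,banach} \<Rightarrow>\<^sub>L 'a"
  assumes C: "compact_op (adj C)" and B: "finite B" "span B = (UNIV :: 'b::{real_inner,banach} set)"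
  shows "compact_op (right_comp_hs C :: ('a, 'b) hs \<Rightarrow>\<^sub>L _)"
proof -
  obtain G :: "'b set" where G: "orthonormal_basis G" using orthonormal_basis_exists by blast
  have "independent G"
    using G by (intro pairwise_orthogonal_independent) (auto simp: orthonormal_basis_def orthonormal_set_def)
  hence fin: "finite G" using independent_span_bound[OF B(1)] B(2) by blast
  define K where "K = closure (blinfun_apply (adj C) ` cball 0 1)"
  have "compact K" using C by (simp add: K_def compact_op_def)
  then obtain M :: "('a, 'b) hs set" where M: "compact M"
    "\<And>w. \<forall>f\<in>G. w f \<in> K \<Longrightarrow> (\<Sum>f\<in>G. rank_one_hs f (w f)) \<in> M"
    using compact_rank_one_hs_sums[OF fin] by blast
  have "right_comp_hs C \<theta> \<in> M" if "norm \<theta> \<le> 1" for \<theta> :: "('a, 'b) hs"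
  proof -
    have "adj C (adj (hs_op \<theta>) f) \<in> K" if "f \<in> G" for f
    proof -
      have "norm (adj (hs_op \<theta>) f) \<le> norm (adj (hs_op \<theta>)) * norm f" by (rule norm_blinfun)
      also have "norm f = 1" using G that by (simp add: orthonormal_basis_def orthonormal_set_def)
      also have "norm (adj (hs_op \<theta>)) * 1 \<le> 1"
        using norm_adj_le[of "hs_op \<theta>"] norm_hs_op_le[of \<theta>] \<open>norm \<theta> \<le> 1\<close> by simp
      finally show ?thesis unfolding K_def by (intro subsetD[OF closure_subset] imageI) simp
    qed
    thus ?thesis unfolding right_comp_hs_finite_expansion[OF G fin] by (intro M(2)) blast
  qed
  hence "blinfun_apply (right_comp_hs C) ` cball 0 1 \<subseteq> M" by auto
  hence "closure (blinfun_apply (right_comp_hs C) ` cball 0 1) \<subseteq> M"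
    by (rule closure_minimal) (rule compact_imp_closed[OF M(1)])
  thus ?thesis unfolding compact_op_def
    using M(1) by (metis closed_closure compact_Int_closed inf.absorb_iff2)
qed

text \<open>
  If \<open>w = C\<^sup>* v\<close> is nonzero with \<open>\<parallel>v\<parallel> \<le> 1\<close>, then for orthonormal \<open>f\<close> the images \<open>f \<otimes> w\<close> of the
  operators \<open>f \<otimes> v\<close> are at mutual distance \<open>\<surd>2 \<parallel>w\<parallel>\<close>, and a totally bounded set contains only
  finitely many such points.
\<close>

lemma compact_op_right_comp_hs_imp_finite_dim:
  fixes C :: "'a::{real_inner,banach} \<Rightarrow>\<^sub>L 'a"
  assumes compact: "compact_op (right_comp_hs C :: ('a, 'b::{real_inner,banach}) hs \<Rightarrow>\<^sub>L _)"
    and "C \<noteq> 0"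
  shows "\<exists>B :: 'b set. finite B \<and> span B = UNIV"
proof -
  obtain G :: "'b set" where G: "orthonormal_basis G" using orthonormal_basis_exists by blast
  have ortho: "orthonormal_set G" using G by (simp add: orthonormal_basis_def)
  have "adj C \<noteq> 0" using \<open>C \<noteq> 0\<close> adj_adj[of C] adj_zero by metis
  then obtain x where x: "adj C x \<noteq> 0" by (metis blinfun_eqI zero_blinfun.rep_eq)
  define v where "v = x /\<^sub>R norm x"
  define w where "w = adj C v"
  have "x \<noteq> 0" using x by auto
  hence v: "norm v \<le> 1" by (simp add: v_def)
  have w: "norm w > 0" using x \<open>x \<noteq> 0\<close> by (simp add: w_def v_def blinfun.scaleR_right)
  define K where "K = closure (blinfun_apply (right_comp_hs C :: ('a, 'b) hs \<Rightarrow>\<^sub>L _) ` cball 0 1)"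
  have in_K: "rank_one_hs f w \<in> K" if "f \<in> G" for f
  proof -
    have "norm f = 1" using that ortho by (simp add: orthonormal_set_def)
    hence "rank_one_hs f v \<in> cball 0 1" using v by (simp add: norm_rank_one_hs)
    moreover have "rank_one_hs f w = right_comp_hs C (rank_one_hs f v)"
      by (rule hs_eqI) (simp add: right_comp_hs.rep_eq hs_compose.rep_eq rank_one_hs.rep_eq
          rank_one_compose w_def)
    ultimately show ?thesis unfolding K_def by (intro subsetD[OF closure_subset]) blast
  qed
  have separated: "(dist (rank_one_hs f w) (rank_one_hs g w))\<^sup>2 = 2 * (norm w)\<^sup>2"
    if "f \<in> G" "g \<in> G" "f \<noteq> g" for f g
    using orthonormal_inner[OF ortho] that
    by (simp add: dist_norm power2_norm_eq_inner inner_diff_left inner_diff_right inner_rank_one_hs)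
  have "compact K" using compact by (simp add: K_def compact_op_def)
  then obtain k where k: "finite k" "K \<subseteq> (\<Union>z\<in>k. ball z (norm w / 2))"
    unfolding compact_eq_totally_bounded using w by (meson half_gt_zero)
  have "\<exists>z\<in>k. dist z (rank_one_hs f w) < norm w / 2" if "f \<in> G" for f
  proof -
    have "rank_one_hs f w \<in> (\<Union>z\<in>k. ball z (norm w / 2))" using in_K[OF that] k(2) by (rule subsetD[rotated])
    thus ?thesis by (simp only: UN_iff mem_ball)
  qed
  then obtain z where z: "\<And>f. f \<in> G \<Longrightarrow> z f \<in> k"
    "\<And>f. f \<in> G \<Longrightarrow> dist (z f) (rank_one_hs f w) < norm w / 2" by metis
  have "inj_on z G"
  proof (rule inj_onI, rule ccontr)
    fix f g assume fg: "f \<in> G" "g \<in> G" "z f = z g" "f \<noteq> g"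
    have "dist (rank_one_hs f w) (rank_one_hs g w) \<le> norm w"
      using z(2)[OF fg(1)] z(2)[OF fg(2)] fg(3)
        dist_triangle2[of "rank_one_hs f w" "rank_one_hs g w" "z g"]
      by (simp add: dist_commute)
    hence "2 * (norm w)\<^sup>2 \<le> (norm w)\<^sup>2"
      unfolding separated[OF fg(1,2,4), symmetric] by (intro power_mono) auto
    thus False using w by simp
  qed
  hence fin: "finite G" using k(1) z(1) by (meson finite_subset finite_imageD image_subsetI)
  have "y \<in> span G" for y
    by (subst finite_orthonormal_basis_expansion[OF G fin, of y]) (intro span_sum span_scale span_base)
  thus ?thesis using fin by blast
qed

section \<open>The properties of precomposition\<close>

theorem theorem3p18:
  fixes C :: "'x::{real_inner,banach} \<Rightarrow>\<^sub>L 'x"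
    and A\<^sub>L :: "('x \<Rightarrow>\<^sub>L 'y::{real_inner,banach}) \<Rightarrow>\<^sub>L ('x \<Rightarrow>\<^sub>L 'y)"
    and A\<^sub>S :: "('x, 'y) hs \<Rightarrow>\<^sub>L ('x, 'y) hs"
  assumes "separable_space (euclidean :: 'x topology)"
    and "separable_space (euclidean :: 'y topology)"
    and "A\<^sub>L = right_comp C"
    and "A\<^sub>S = right_comp_hs C"
  shows
    "((\<exists>y::'y. y \<noteq> 0) \<longrightarrow> point_spectrum A\<^sub>L = point_spectrum (adj C)) \<and>
     (\<forall>\<mu>. eigenspace \<mu> A\<^sub>L \<inter> range (map_prod hs_op hs_op)
        = map_prod hs_op hs_op ` cx_hs_tensor (eigenspace \<mu> (adj C))) \<and>
     (\<forall>\<mu>. eigenspace \<mu> A\<^sub>S = cx_hs_tensor (eigenspace \<mu> (adj C))) \<and>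
     ((\<exists>y::'y. y \<noteq> 0) \<longrightarrow>
        (\<forall>\<mu> (v :: 'x) (y :: 'y).
          ((\<mu> \<in> point_spectrum (adj C) \<and> cx_of v \<in> eigenspace \<mu> (adj C)) \<longrightarrow>
             (\<mu> \<in> point_spectrum A\<^sub>L \<and>
              cx_of (rank_one y v) \<in> eigenspace \<mu> A\<^sub>L)) \<and>
          (y \<noteq> 0 \<longrightarrow>
            ((\<mu> \<in> point_spectrum (adj C) \<and> cx_of v \<in> eigenspace \<mu> (adj C)) \<longleftrightarrow>
             (\<mu> \<in> point_spectrum A\<^sub>L \<and>
              cx_of (rank_one y v) \<in> eigenspace \<mu> A\<^sub>L)))) \<and>
        (\<forall>\<mu> (v :: 'x \<times> 'x) (y :: 'y \<times> 'y).
          ((\<mu> \<in> point_spectrum (adj C) \<and> v \<in> eigenspace \<mu> (adj C)) \<longrightarrow>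
             (\<mu> \<in> point_spectrum A\<^sub>L \<and>
              cx_bilinear rank_one y v \<in> eigenspace \<mu> A\<^sub>L)) \<and>
          (y \<noteq> 0 \<longrightarrow>
            ((\<mu> \<in> point_spectrum (adj C) \<and> v \<in> eigenspace \<mu> (adj C)) \<longleftrightarrow>
             (\<mu> \<in> point_spectrum A\<^sub>L \<and>
              cx_bilinear rank_one y v \<in> eigenspace \<mu> A\<^sub>L))))) \<and>
     adj A\<^sub>S = right_comp_hs (adj C) \<and>
     (adj C = C \<longrightarrow> adj A\<^sub>S = A\<^sub>S) \<and>
     ((\<exists>y::'y. y \<noteq> 0) \<longrightarrow>
        point_spectrum A\<^sub>S = point_spectrum (adj C) \<and>
        continuous_spectrum A\<^sub>S = continuous_spectrum (adj C) \<and>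
        residual_spectrum A\<^sub>S = residual_spectrum (adj C)) \<and>
     (compact_op C \<and> adj C = C \<longrightarrow>
        point_spectrum C \<subseteq> \<real> \<and>
        (((\<lambda>\<mu>. Re \<mu> *\<^sub>R orth_proj (real_eigenspace (Re \<mu>) C)) has_sum C) (point_spectrum C) \<longrightarrow>
         ((\<lambda>\<mu>. Re \<mu> *\<^sub>R orth_proj (hs_tensor (real_eigenspace (Re \<mu>) C)))
            has_sum A\<^sub>S) (point_spectrum C))) \<and>
     (compact_op C \<and> adj C = C \<longrightarrow>
        ((\<exists>B :: 'y set. finite B \<and> span B = UNIV) \<longrightarrow> compact_op A\<^sub>S) \<and>
        (C \<noteq> 0 \<longrightarrow>
           (compact_op A\<^sub>S \<longleftrightarrow> (\<exists>B :: 'y set. finite B \<and> span B = UNIV))))"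
proof -
  note A\<^sub>L = assms(3) and A\<^sub>S = assms(4)
  have eig_S: "eigenspace \<mu> A\<^sub>S = cx_hs_tensor (eigenspace \<mu> (adj C))" for \<mu>
    unfolding A\<^sub>S by (rule eigenspace_right_comp_hs)
  have eig_L: "eigenspace \<mu> A\<^sub>L \<inter> range (map_prod hs_op hs_op)
      = map_prod hs_op hs_op ` cx_hs_tensor (eigenspace \<mu> (adj C))" for \<mu>
  proof -
    have "eigenspace \<mu> A\<^sub>S = map_prod hs_op hs_op -` eigenspace \<mu> A\<^sub>L"
      unfolding A\<^sub>S A\<^sub>L by (rule set_eqI) (simp only: vimage_eq eigenspace_right_comp_hs_iff)
    thus ?thesis by (simp only: image_vimage_eq flip: eig_S)
  qed
  have point_L: "point_spectrum A\<^sub>L = point_spectrum (adj C)" if "\<exists>y::'y. y \<noteq> 0"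
    unfolding A\<^sub>L point_spectrum_def inj_right_comp_iff[OF that] ..
  have eig_bilinear: "cx_bilinear rank_one y v \<in> eigenspace \<mu> A\<^sub>L \<longleftrightarrow> v \<in> eigenspace \<mu> (adj C)"
    if "y \<noteq> 0" for \<mu> and v :: "'x \<times> 'x" and y :: "'y \<times> 'y"
    using cx_bilinear_rank_one_eq_0_imp[OF _ that] cx_bilinear_rank_one_zero_right[of y]
    unfolding A\<^sub>L eigenspace_def mem_Collect_eq cx_shift_cx_bilinear_rank_one by metis
  have eig_bilinear': "cx_bilinear rank_one y v \<in> eigenspace \<mu> A\<^sub>L" if "v \<in> eigenspace \<mu> (adj C)"
    for \<mu> and v :: "'x \<times> 'x" and y :: "'y \<times> 'y"
    using that unfolding A\<^sub>L eigenspace_def mem_Collect_eq cx_shift_cx_bilinear_rank_one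
    by (simp only: cx_bilinear_rank_one_zero_right)
  have cx_of_rank_one: "cx_of (rank_one y v) = cx_bilinear rank_one (cx_of y) (cx_of v)"
    for v :: 'x and y :: 'y
  proof -
    have "rank_one y (0 :: 'x) = 0" "rank_one (0 :: 'y) v = 0" "rank_one (0 :: 'y) (0 :: 'x) = 0"
      by (auto intro!: blinfun_eqI simp: rank_one.rep_eq)
    thus ?thesis by (simp add: cx_of_def cx_bilinear_def)
  qed
  have cx_of_nonzero: "cx_of y \<noteq> 0" if "y \<noteq> 0" for y :: 'y
    using that by (simp add: cx_of_def zero_prod_def)
  have a: "(\<exists>y::'y. y \<noteq> 0) \<longrightarrow>
        (\<forall>\<mu> (v :: 'x) (y :: 'y).
          ((\<mu> \<in> point_spectrum (adj C) \<and> cx_of v \<in> eigenspace \<mu> (adj C)) \<longrightarrow>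
             (\<mu> \<in> point_spectrum A\<^sub>L \<and> cx_of (rank_one y v) \<in> eigenspace \<mu> A\<^sub>L)) \<and>
          (y \<noteq> 0 \<longrightarrow>
            ((\<mu> \<in> point_spectrum (adj C) \<and> cx_of v \<in> eigenspace \<mu> (adj C)) \<longleftrightarrow>
             (\<mu> \<in> point_spectrum A\<^sub>L \<and> cx_of (rank_one y v) \<in> eigenspace \<mu> A\<^sub>L)))) \<and>
        (\<forall>\<mu> (v :: 'x \<times> 'x) (y :: 'y \<times> 'y).
          ((\<mu> \<in> point_spectrum (adj C) \<and> v \<in> eigenspace \<mu> (adj C)) \<longrightarrow>
             (\<mu> \<in> point_spectrum A\<^sub>L \<and> cx_bilinear rank_one y v \<in> eigenspace \<mu> A\<^sub>L)) \<and>
          (y \<noteq> 0 \<longrightarrow>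
            ((\<mu> \<in> point_spectrum (adj C) \<and> v \<in> eigenspace \<mu> (adj C)) \<longleftrightarrow>
             (\<mu> \<in> point_spectrum A\<^sub>L \<and> cx_bilinear rank_one y v \<in> eigenspace \<mu> A\<^sub>L))))"
    by (intro conjI allI impI)
       (simp_all add: point_L cx_of_rank_one eig_bilinear eig_bilinear' cx_of_nonzero)
  have c: "point_spectrum A\<^sub>S = point_spectrum (adj C) \<and>
        continuous_spectrum A\<^sub>S = continuous_spectrum (adj C) \<and>
        residual_spectrum A\<^sub>S = residual_spectrum (adj C)" if "\<exists>y::'y. y \<noteq> 0"
    unfolding A\<^sub>S point_spectrum_def continuous_spectrum_def residual_spectrum_def
      inj_right_comp_hs_iff[OF that] surj_right_comp_hs_iff[OF that]
      closure_range_right_comp_hs_iff[OF that] by blast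
  \<comment> \<open>The assignment \<open>C \<mapsto> A\<^sub>C\<close>, being continuous and linear, is applied to the series term by term.\<close>
  have d: "((\<lambda>\<mu>. Re \<mu> *\<^sub>R orth_proj (hs_tensor (real_eigenspace (Re \<mu>) C))) has_sum A\<^sub>S)
      (point_spectrum C)"
    if "((\<lambda>\<mu>. Re \<mu> *\<^sub>R orth_proj (real_eigenspace (Re \<mu>) C)) has_sum C) (point_spectrum C)"
    using has_sum_bounded_linear[OF bounded_linear_right_comp_hs[where 'b = 'y] that]
    by (simp add: A\<^sub>S linear_scale[OF bounded_linear.linear[OF bounded_linear_right_comp_hs]]
        right_comp_hs_orth_proj subspace_real_eigenspace closed_real_eigenspace)
  have e: "compact_op A\<^sub>S" if "compact_op C" "adj C = C" "\<exists>B :: 'y set. finite B \<and> span B = UNIV"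
    using that compact_op_right_comp_hs[of C] unfolding A\<^sub>S by auto
  have e': "\<exists>B :: 'y set. finite B \<and> span B = UNIV" if "C \<noteq> 0" "compact_op A\<^sub>S"
    using that unfolding A\<^sub>S by (intro compact_op_right_comp_hs_imp_finite_dim)
  have b: "adj A\<^sub>S = right_comp_hs (adj C)" unfolding A\<^sub>S by (rule adj_right_comp_hs)
  have b': "adj A\<^sub>S = A\<^sub>S" if "adj C = C" using b that A\<^sub>S by simp
  show ?thesis
    by (intro conjI, rule impI, erule point_L, rule allI, rule eig_L, rule allI, rule eig_S, rule a,
        rule b, rule impI, erule b', rule impI, erule c,
        intro conjI impI, rule self_adjoint_point_spectrum_real, erule conjunct2, erule d,
        intro conjI impI iffI, erule conjE, erule (2) e, erule (1) e', erule conjE, erule (2) e)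
qed

end
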